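(* Let $1\le p\le 2$. For $m\in\mathbb{N}$ and $\varepsilon,\delta\in(0,1)$, the randomized algorithm $A_p^{\varepsilon,\delta}$ (defined in the context) satisfies $$\sup_{\boldsymbol{x}\in\mathbb{R}^m,\ \|\boldsymbol{x}\|_p\le 1}\mathbb{P}\left(\|A_p^{\varepsilon,\delta}(\boldsymbol{x})-\boldsymbol{x}\|_\infty>\varepsilon\right)\le\delta .$$ Moreover, there exists a constant $C_p>0$, depending only on $p$, such that for all $m\ge 16$ and all $0<\varepsilon,\delta<\tfrac12$, $$\mathrm{card}(A_p^{\varepsilon,\delta})\ \le\ C_p\left(\log\delta^{-1}+\log\varepsilon^{-1}+\log\log m\right)\varepsilon^{-p}.$$
   Context: Notation: $[m]=\{1,\ldots,m\}$; $\mathrm{unif}$ denotes the uniform distribution; $\log$ is the natural logarithm; $\|\boldsymbol{x}\|_p=(\sum_i|x_i|^p)^{1/p}$, $\|\boldsymbol{x}\|_\infty=\max_i|x_i|$. $\mathrm{card}(A)$ is the maximal number of linear functionals of the input $\boldsymbol{x}$ that the algorithm $A$ evaluates. Subroutine BucketSelect. Given $\boldsymbol{h}\in[D]^m$ with buckets $J_d=\{i\in[m]:h_i=d\}$, $d\in[D]$, and $R,G,k\in\mathbb{N}$, $R$ odd, $k\le D$: draw independent hash vectors $\boldsymbol{H}^{(1)},\ldots,\boldsymbol{H}^{(R)}\sim\mathrm{unif}([G]^D)$ and independent signs $\sigma_{ri}\sim\mathrm{unif}\{\pm1\}$ ($r\in[R]$, $i\in[m]$), all independent. Measure $Y_{r,g}=\sum_{d\in[D]:H_d^{(r)}=g}\sum_{i\in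 J_d}\sigma_{ri}x_i$ for $r\in[R]$, $g\in[G]$ ($RG$ measurements), and put $\hat Y_{r,d}=Y_{r,H_d^{(r)}}$ and $Z_d=\mathrm{med}\{|\hat Y_{r,d}|:r\in[R]\}$. Output a set $I_k\subseteq[D]$ with $\#I_k=k$ and $\min\{Z_d:d\in I_k\}\ge\max\{Z_d:d\in[D]\setminus I_k\}$. Subroutine Shrink. Given $S_0\subseteq[m]$ and a hash vector $\boldsymbol{h}$ with values in $[D_0]$: with pairwise independent $\sigma_i\sim\mathrm{unif}\{\pm1\}$, measure $Y_1=\sum_{i\in S_0}\sigma_ix_i$ and $Y_2=\sum_{i\in S_0}(h_i-\frac{D_0+1}{2})\sigma_ix_i$, and output $\mathrm{Shrink}_{\boldsymbol{h}}(\boldsymbol{x},S_0)=\{i\in S_0:h_i=\lceil Y_2/Y_1+D_0/2\rceil\}$, with the empty set as output if $Y_1=0$. Subroutine Spot. Given $\alpha\in(0,1)$ and $J\subseteq[m]$: let $k^\ast=\max\{0,\lceil\log_{9/8}\frac{\log_2 m}{8}\rceil\}$ ($k^\ast=0$ for $m=1$) and $D_k=\lceil 2^{8(9/8)^k+k+2}\alpha^{-1}\rceil$. For $k=0,\ldots,k^\ast-1$ let $\boldsymbol{H}^{(k)}=(H^{(k)}_i)_{i\in J}$ be independent hash vectors, each with pairwise independent entries $H_i^{(k)}\sim\mathrm{unif}[D_k]$, independent of the signs used in Shrink. Put $S_0=J$ and, as long as $\#S_k>1$ and $k<k^\ast$, $S_{k+1}=\mathrm{Shrink}_{\boldsymbol{H}^{(k)}}(\boldsymbol{x},S_k)$;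 if a set $S_k$ with $\#S_k\le1$ occurs, it is the output. If still $\#S_{k^\ast}>1$, output $\mathrm{Shrink}_{\boldsymbol{h}^\ast}(\boldsymbol{x},S_{k^\ast})$, where $\boldsymbol{h}^\ast$ is injective on $S_{k^\ast}$ with values in $[\#S_{k^\ast}]$ (so $D_0=\#S_{k^\ast}$ there). The output is denoted $\mathrm{Spot}_\alpha(\boldsymbol{x},J)$. (The same signs may be used for all shrinking steps.) The algorithm $A_p^{\varepsilon,\delta}$. Parameters: $k_0=\lfloor\varepsilon^{-p}\rfloor$, $\delta_0=\delta_1=\delta/4$, $\alpha=\delta/(2k_0)$, $\gamma=2049\sqrt2\,\alpha^{-3/2}$, $D=\lceil(\gamma/\varepsilon)^pk_0/\delta_0\rceil$, $R=2\lceil\log_2\frac{D}{2\delta_1}-\frac12\rceil+1$, $k=\lfloor2^{7p/2}\varepsilon^{-p}\rfloor$, $G=4k$. 1. Draw a hash vector $\boldsymbol{H}=(H_i)_{i=1}^m$ with pairwise independent $H_i\sim\mathrm{unif}[D]$, let $J_d=\{i\in[m]:H_i=d\}$, and compute $I_k\subseteq[D]$ by BucketSelect with parameters $R,G,k$ and hash vector $\boldsymbol{H}$. 2. Compute $K=\bigcup_{d\in I_k}\mathrm{Spot}_\alpha(\boldsymbol{x},J_d)$. 3. Observe $x_i$ for $i\in K$ and output $\boldsymbol{z}$ with $z_i=x_i$ for $i\in K$ and $z_i=0$ otherwise; this is $A_p^{\varepsilon,\delta}(\boldsymbol{x})$. The random parameters of the subroutines are independent of $\boldsymbol{H}$, and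 the random parameters of BucketSelect are independent of those of Spot. *)

theory Defs
  imports "HOL-Probability.Probability"
begin

section \<open>Vectors, norms, medians\<close>

text \<open>
  A vector of \<open>\<real>\<^sup>m\<close> is a function of type \<open>nat \<Rightarrow> real\<close> of which only the entries with index
  in \<open>{1..m}\<close> are ever used; likewise a hash vector in \<open>[D]\<^sup>m\<close> is a function \<open>nat \<Rightarrow> nat\<close>.
\<close>

type_synonym vec = "nat \<Rightarrow> real"

definition lp_norm :: "real \<Rightarrow> nat \<Rightarrow> vec \<Rightarrow> real" where
  "lp_norm p m x = (\<Sum>i\<in>{1..m}. \<bar>x i\<bar> powr p) powr (1 / p)"

definition linf_norm :: "nat \<Rightarrow> vec \<Rightarrow> real" where
  "linf_norm m x = Max ((\<lambda>i. \<bar>x i\<bar>) ` {1..m})"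

text \<open>Used for lists of odd length only.\<close>

definition med :: "real list \<Rightarrow> real" where
  "med xs = sort xs ! (length xs div 2)"

section \<open>BucketSelect\<close>

definition bucket :: "nat \<Rightarrow> (nat \<Rightarrow> nat) \<Rightarrow> nat \<Rightarrow> nat set" where
  "bucket m h d = {i \<in> {1..m}. h i = d}"

text \<open>The functional \<open>Y\<^sub>r\<^sub>,\<^sub>g\<close>; here \<open>H\<close> and \<open>\<sigma>\<close> are the \<open>r\<close>-th hash vector and the \<open>r\<close>-th row of signs.\<close>

definition bs_meas ::
  "nat \<Rightarrow> nat \<Rightarrow> (nat \<Rightarrow> nat) \<Rightarrow> (nat \<Rightarrow> nat) \<Rightarrow> (nat \<Rightarrow> real) \<Rightarrow> nat \<Rightarrow> vec \<Rightarrow> real" where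
  "bs_meas m D h H \<sigma> g x = (\<Sum>d | d \<in> {1..D} \<and> H d = g. \<Sum>i\<in>bucket m h d. \<sigma> i * x i)"

definition bs_Z ::
  "nat \<Rightarrow> nat \<Rightarrow> nat \<Rightarrow> (nat \<Rightarrow> nat) \<Rightarrow> (nat \<Rightarrow> nat \<Rightarrow> nat) \<Rightarrow> (nat \<Rightarrow> nat \<Rightarrow> real) \<Rightarrow> vec \<Rightarrow> nat \<Rightarrow> real"
where
  "bs_Z m D R h H \<sigma> x d = med (map (\<lambda>r. \<bar>bs_meas m D h (H r) (\<sigma> r) (H r d) x\<bar>) [1..<Suc R])"

text \<open>
  The output of BucketSelect is determined by \<open>Z\<^sub>1, \<dots>, Z\<^sub>D\<close> up to ties. A selection rule fixes how
  ties are broken; statements about the algorithm are meant for every such rule.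
\<close>

definition selection_rule :: "nat \<Rightarrow> nat \<Rightarrow> ((nat \<Rightarrow> real) \<Rightarrow> nat set) \<Rightarrow> bool" where
  "selection_rule D k sel \<longleftrightarrow>
     (\<forall>Z. sel Z \<subseteq> {1..D} \<and> card (sel Z) = k \<and> (\<forall>d\<in>sel Z. \<forall>d'\<in>{1..D} - sel Z. Z d \<ge> Z d'))"

definition bucket_select ::
  "((nat \<Rightarrow> real) \<Rightarrow> nat set) \<Rightarrow> nat \<Rightarrow> nat \<Rightarrow> nat \<Rightarrow> (nat \<Rightarrow> nat) \<Rightarrow> (nat \<Rightarrow> nat \<Rightarrow> nat) \<Rightarrow>
   (nat \<Rightarrow> nat \<Rightarrow> real) \<Rightarrow> vec \<Rightarrow> nat set" where
  "bucket_select sel m D R h H \<sigma> x = sel (\<lambda>d\<in>{1..D}. bs_Z m D R h H \<sigma> x d)"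

section \<open>Shrink\<close>

definition shrink_meas1 :: "(nat \<Rightarrow> real) \<Rightarrow> nat set \<Rightarrow> vec \<Rightarrow> real" where
  "shrink_meas1 \<sigma> S x = (\<Sum>i\<in>S. \<sigma> i * x i)"

definition shrink_meas2 :: "nat \<Rightarrow> (nat \<Rightarrow> nat) \<Rightarrow> (nat \<Rightarrow> real) \<Rightarrow> nat set \<Rightarrow> vec \<Rightarrow> real" where
  "shrink_meas2 D h \<sigma> S x = (\<Sum>i\<in>S. (real (h i) - (real D + 1) / 2) * \<sigma> i * x i)"

definition shrink :: "nat \<Rightarrow> (nat \<Rightarrow> nat) \<Rightarrow> (nat \<Rightarrow> real) \<Rightarrow> vec \<Rightarrow> nat set \<Rightarrow> nat set" where
  "shrink D h \<sigma> x S =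
     (if shrink_meas1 \<sigma> S x = 0 then {}
      else {i \<in> S. int (h i) = \<lceil>shrink_meas2 D h \<sigma> S x / shrink_meas1 \<sigma> S x + real D / 2\<rceil>})"

section \<open>Spot\<close>

definition spot_steps :: "nat \<Rightarrow> nat" where
  "spot_steps m = (if m = 1 then 0 else nat (max 0 \<lceil>log (9/8) (log 2 (real m) / 8)\<rceil>))"

definition spot_range :: "real \<Rightarrow> nat \<Rightarrow> nat" where
  "spot_range \<alpha> k = nat \<lceil>2 powr (8 * (9/8) ^ k + real k + 2) / \<alpha>\<rceil>"

text \<open>The rule fixing the choice of \<open>h\<^sup>*\<close> for the final shrinking of a set \<open>S\<close>.\<close>

definition injection_rule :: "(nat set \<Rightarrow> nat \<Rightarrow> nat) \<Rightarrow> bool" where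
  "injection_rule hstar \<longleftrightarrow>
     (\<forall>S. finite S \<longrightarrow> inj_on (hstar S) S \<and> hstar S ` S \<subseteq> {1..card S})"

text \<open>
  The range and the hash vector used in shrinking step \<open>k\<close>: steps \<open>k < k\<^sup>*\<close> use the \<open>k\<close>-th random
  hash vector, step \<open>k\<^sup>*\<close> is the final one with \<open>h\<^sup>*\<close>.
\<close>

definition step_range :: "nat \<Rightarrow> real \<Rightarrow> nat \<Rightarrow> nat set \<Rightarrow> nat" where
  "step_range m \<alpha> k S = (if k < spot_steps m then spot_range \<alpha> k else card S)"

definition step_hash ::
  "(nat set \<Rightarrow> nat \<Rightarrow> nat) \<Rightarrow> nat \<Rightarrow> (nat \<Rightarrow> nat \<Rightarrow> nat) \<Rightarrow> nat \<Rightarrow> nat set \<Rightarrow> nat \<Rightarrow> nat" where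
  "step_hash hstar m H k S = (if k < spot_steps m then H k else hstar S)"

text \<open>
  The set \<open>S\<^sub>k\<close>. A set with at most one element is the output of Spot, so the sequence is constant
  from there on; thus the output is the set with index \<open>k\<^sup>* + 1\<close> in every case.
  Step \<open>k\<close> uses the signs \<open>\<sigma> k\<close>, which may or may not be the same for all \<open>k\<close>.
\<close>

primrec spot_set ::
  "(nat set \<Rightarrow> nat \<Rightarrow> nat) \<Rightarrow> nat \<Rightarrow> real \<Rightarrow> (nat \<Rightarrow> nat \<Rightarrow> nat) \<Rightarrow> (nat \<Rightarrow> nat \<Rightarrow> real) \<Rightarrow> vec \<Rightarrow>
   nat set \<Rightarrow> nat \<Rightarrow> nat set" where
  "spot_set hstar m \<alpha> H \<sigma> x J 0 = J"
| "spot_set hstar m \<alpha> H \<sigma> x J (Suc k) =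
     (let S = spot_set hstar m \<alpha> H \<sigma> x J k in
      if card S > 1 then shrink (step_range m \<alpha> k S) (step_hash hstar m H k S) (\<sigma> k) x S else S)"

definition spot ::
  "(nat set \<Rightarrow> nat \<Rightarrow> nat) \<Rightarrow> nat \<Rightarrow> real \<Rightarrow> (nat \<Rightarrow> nat \<Rightarrow> nat) \<Rightarrow> (nat \<Rightarrow> nat \<Rightarrow> real) \<Rightarrow> vec \<Rightarrow>
   nat set \<Rightarrow> nat set" where
  "spot hstar m \<alpha> H \<sigma> x J = spot_set hstar m \<alpha> H \<sigma> x J (Suc (spot_steps m))"

text \<open>The list of functionals that Spot evaluates on input \<open>x\<close>.\<close>

definition spot_queries ::
  "(nat set \<Rightarrow> nat \<Rightarrow> nat) \<Rightarrow> nat \<Rightarrow> real \<Rightarrow> (nat \<Rightarrow> nat \<Rightarrow> nat) \<Rightarrow> (nat \<Rightarrow> nat \<Rightarrow> real) \<Rightarrow> vec \<Rightarrow>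
   nat set \<Rightarrow> (vec \<Rightarrow> real) list" where
  "spot_queries hstar m \<alpha> H \<sigma> x J =
     concat (map (\<lambda>k. let S = spot_set hstar m \<alpha> H \<sigma> x J k in
                      if card S > 1
                      then [shrink_meas1 (\<sigma> k) S,
                            shrink_meas2 (step_range m \<alpha> k S) (step_hash hstar m H k S) (\<sigma> k) S]
                      else [])
       [0..<Suc (spot_steps m)])"

section \<open>The parameters of the algorithm\<close>

definition A_k0 :: "real \<Rightarrow> real \<Rightarrow> nat" where
  "A_k0 p \<epsilon> = nat \<lfloor>\<epsilon> powr (- p)\<rfloor>"

definition A_delta0 :: "real \<Rightarrow> real" where
  "A_delta0 \<delta> = \<delta> / 4"

definition A_delta1 :: "real \<Rightarrow> real" where
  "A_delta1 \<delta> = \<delta> / 4"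

definition A_alpha :: "real \<Rightarrow> real \<Rightarrow> real \<Rightarrow> real" where
  "A_alpha p \<epsilon> \<delta> = \<delta> / (2 * real (A_k0 p \<epsilon>))"

definition A_gamma :: "real \<Rightarrow> real \<Rightarrow> real \<Rightarrow> real" where
  "A_gamma p \<epsilon> \<delta> = 2049 * sqrt 2 * A_alpha p \<epsilon> \<delta> powr (- 3/2)"

definition A_D :: "real \<Rightarrow> real \<Rightarrow> real \<Rightarrow> nat" where
  "A_D p \<epsilon> \<delta> = nat \<lceil>(A_gamma p \<epsilon> \<delta> / \<epsilon>) powr p * real (A_k0 p \<epsilon>) / A_delta0 \<delta>\<rceil>"

definition A_R :: "real \<Rightarrow> real \<Rightarrow> real \<Rightarrow> nat" where
  "A_R p \<epsilon> \<delta> = nat (2 * \<lceil>log 2 (real (A_D p \<epsilon> \<delta>) / (2 * A_delta1 \<delta>)) - 1/2\<rceil> + 1)"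

definition A_k :: "real \<Rightarrow> real \<Rightarrow> nat" where
  "A_k p \<epsilon> = nat \<lfloor>2 powr (7 * p / 2) * \<epsilon> powr (- p)\<rfloor>"

definition A_G :: "real \<Rightarrow> real \<Rightarrow> nat" where
  "A_G p \<epsilon> = 4 * A_k p \<epsilon>"

section \<open>Random parameters\<close>

text \<open>
  A seed holds the values of all random parameters:
  \<open>main_hash i\<close> is \<open>H\<^sub>i\<close>; \<open>group_hash r d\<close> is \<open>H\<^sub>d\<^sup>(\<^sup>r\<^sup>)\<close> and \<open>bs_sign r i\<close> is \<open>\<sigma>\<^sub>r\<^sub>i\<close> in BucketSelect;
  \<open>spot_hash d k i\<close> and \<open>spot_sign d k i\<close> are the hash value and the sign of coordinate \<open>i\<close> in
  shrinking step \<open>k\<close> of Spot when it is called for the bucket \<open>J\<^sub>d\<close>.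
\<close>

record seed =
  main_hash :: "nat \<Rightarrow> nat"
  group_hash :: "nat \<Rightarrow> nat \<Rightarrow> nat"
  bs_sign :: "nat \<Rightarrow> nat \<Rightarrow> real"
  spot_hash :: "nat \<Rightarrow> nat \<Rightarrow> nat \<Rightarrow> nat"
  spot_sign :: "nat \<Rightarrow> nat \<Rightarrow> nat \<Rightarrow> real"

text \<open>
  The joint law of the random parameters is a \<open>pmf\<close> on seeds. This is no restriction, since only
  finitely many random parameters occur and each takes finitely many values.
\<close>

definition uniform_rv :: "'s pmf \<Rightarrow> ('s \<Rightarrow> 'a) \<Rightarrow> 'a set \<Rightarrow> bool" where
  "uniform_rv P X A \<longleftrightarrow> map_pmf X P = pmf_of_set A"

definition indep_family :: "'s pmf \<Rightarrow> ('i \<Rightarrow> 's \<Rightarrow> 'a) \<Rightarrow> 'i set \<Rightarrow> bool" where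
  "indep_family P X I \<longleftrightarrow> prob_space.indep_vars (measure_pmf P) (\<lambda>_. count_space UNIV) X I"

definition pairwise_indep :: "'s pmf \<Rightarrow> ('i \<Rightarrow> 's \<Rightarrow> 'a) \<Rightarrow> 'i set \<Rightarrow> bool" where
  "pairwise_indep P X I \<longleftrightarrow>
     (\<forall>i\<in>I. \<forall>j\<in>I. i \<noteq> j \<longrightarrow>
        prob_space.indep_var (measure_pmf P) (count_space UNIV) (X i) (count_space UNIV) (X j))"

text \<open>
  Independence of two random variables of different types (which \<open>indep_var\<close> does not cover):
  the generated sigma-algebras are independent.
\<close>

definition indep_pair :: "'s pmf \<Rightarrow> ('s \<Rightarrow> 'a) \<Rightarrow> ('s \<Rightarrow> 'b) \<Rightarrow> bool" where
  "indep_pair P X Y \<longleftrightarrow>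
     prob_space.indep_set (measure_pmf P) (range (\<lambda>A. X -` A)) (range (\<lambda>B. Y -` B))"

definition main_law :: "nat \<Rightarrow> nat \<Rightarrow> seed pmf \<Rightarrow> bool" where
  "main_law m D P \<longleftrightarrow>
     (\<forall>i\<in>{1..m}. uniform_rv P (\<lambda>s. main_hash s i) {1..D}) \<and>
     pairwise_indep P (\<lambda>i s. main_hash s i) {1..m}"

definition bs_hashes :: "nat \<Rightarrow> nat \<Rightarrow> seed \<Rightarrow> nat \<Rightarrow> nat \<Rightarrow> nat" where
  "bs_hashes D R s = (\<lambda>r\<in>{1..R}. \<lambda>d\<in>{1..D}. group_hash s r d)"

definition bs_signs :: "nat \<Rightarrow> nat \<Rightarrow> seed \<Rightarrow> nat \<times> nat \<Rightarrow> real" where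
  "bs_signs m R s = (\<lambda>(r, i)\<in>{1..R} \<times> {1..m}. bs_sign s r i)"

definition bs_law :: "nat \<Rightarrow> nat \<Rightarrow> nat \<Rightarrow> nat \<Rightarrow> seed pmf \<Rightarrow> bool" where
  "bs_law m D R G P \<longleftrightarrow>
     (\<forall>r\<in>{1..R}. uniform_rv P (\<lambda>s. bs_hashes D R s r) ({1..D} \<rightarrow>\<^sub>E {1..G})) \<and>
     (\<forall>ri\<in>{1..R} \<times> {1..m}. uniform_rv P (\<lambda>s. bs_signs m R s ri) {-1, 1}) \<and>
     indep_family P (\<lambda>r s. bs_hashes D R s r) {1..R} \<and>
     indep_family P (\<lambda>ri s. bs_signs m R s ri) ({1..R} \<times> {1..m}) \<and>
     indep_pair P (bs_hashes D R) (bs_signs m R)"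

text \<open>
  Hash vectors and signs of the call of Spot for the bucket \<open>J\<^sub>d\<close>. They are indexed by all of \<open>{1..m}\<close>;
  the call uses the entries with index in \<open>J\<^sub>d\<close>.
\<close>

definition spot_hashes :: "nat \<Rightarrow> nat \<Rightarrow> seed \<Rightarrow> nat \<Rightarrow> nat \<Rightarrow> nat" where
  "spot_hashes m d s = (\<lambda>k\<in>{..<spot_steps m}. \<lambda>i\<in>{1..m}. spot_hash s d k i)"

definition spot_signs :: "nat \<Rightarrow> nat \<Rightarrow> seed \<Rightarrow> nat \<Rightarrow> nat \<Rightarrow> real" where
  "spot_signs m d s = (\<lambda>k\<in>{..spot_steps m}. \<lambda>i\<in>{1..m}. spot_sign s d k i)"

text \<open>
  Nothing is required about the joint law of the signs of different steps, nor about the joint law of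
  the parameters of different calls of Spot: they may be shared or drawn afresh.
\<close>

definition spot_law :: "nat \<Rightarrow> real \<Rightarrow> nat \<Rightarrow> seed pmf \<Rightarrow> bool" where
  "spot_law m \<alpha> d P \<longleftrightarrow>
     (\<forall>k<spot_steps m.
        (\<forall>i\<in>{1..m}. uniform_rv P (\<lambda>s. spot_hashes m d s k i) {1..spot_range \<alpha> k}) \<and>
        pairwise_indep P (\<lambda>i s. spot_hashes m d s k i) {1..m}) \<and>
     indep_family P (\<lambda>k s. spot_hashes m d s k) {..<spot_steps m} \<and>
     (\<forall>k\<le>spot_steps m.
        (\<forall>i\<in>{1..m}. uniform_rv P (\<lambda>s. spot_signs m d s k i) {-1, 1}) \<and>
        pairwise_indep P (\<lambda>i s. spot_signs m d s k i) {1..m}) \<and>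
     indep_pair P (spot_hashes m d) (spot_signs m d)"

definition main_params :: "nat \<Rightarrow> seed \<Rightarrow> nat \<Rightarrow> nat" where
  "main_params m s = (\<lambda>i\<in>{1..m}. main_hash s i)"

definition bs_params ::
  "nat \<Rightarrow> nat \<Rightarrow> nat \<Rightarrow> seed \<Rightarrow> (nat \<Rightarrow> nat \<Rightarrow> nat) \<times> (nat \<times> nat \<Rightarrow> real)" where
  "bs_params m D R s = (bs_hashes D R s, bs_signs m R s)"

definition spot_params ::
  "nat \<Rightarrow> nat \<Rightarrow> seed \<Rightarrow> nat \<Rightarrow> (nat \<Rightarrow> nat \<Rightarrow> nat) \<times> (nat \<Rightarrow> nat \<Rightarrow> real)" where
  "spot_params m D s = (\<lambda>d\<in>{1..D}. (spot_hashes m d s, spot_signs m d s))"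

definition seed_law :: "nat \<Rightarrow> real \<Rightarrow> real \<Rightarrow> real \<Rightarrow> seed pmf \<Rightarrow> bool" where
  "seed_law m p \<epsilon> \<delta> P \<longleftrightarrow>
     (let D = A_D p \<epsilon> \<delta>; R = A_R p \<epsilon> \<delta> in
      main_law m D P \<and>
      bs_law m D R (A_G p \<epsilon>) P \<and>
      (\<forall>d\<in>{1..D}. spot_law m (A_alpha p \<epsilon> \<delta>) d P) \<and>
      indep_pair P (main_params m) (\<lambda>s. (bs_params m D R s, spot_params m D s)) \<and>
      indep_pair P (bs_params m D R) (spot_params m D))"

section \<open>The algorithm\<close>

text \<open>
  An instance of the algorithm consists of a selection rule, a rule for \<open>h\<^sup>*\<close> and a law of the random
  parameters. For a fixed seed the algorithm is a deterministic function of the input.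
\<close>

definition A_instance ::
  "nat \<Rightarrow> real \<Rightarrow> real \<Rightarrow> real \<Rightarrow> ((nat \<Rightarrow> real) \<Rightarrow> nat set) \<Rightarrow> (nat set \<Rightarrow> nat \<Rightarrow> nat) \<Rightarrow>
   seed pmf \<Rightarrow> bool" where
  "A_instance m p \<epsilon> \<delta> sel hstar P \<longleftrightarrow>
     selection_rule (A_D p \<epsilon> \<delta>) (A_k p \<epsilon>) sel \<and> injection_rule hstar \<and> seed_law m p \<epsilon> \<delta> P"

definition A_select ::
  "((nat \<Rightarrow> real) \<Rightarrow> nat set) \<Rightarrow> nat \<Rightarrow> real \<Rightarrow> real \<Rightarrow> real \<Rightarrow> seed \<Rightarrow> vec \<Rightarrow> nat set" where
  "A_select sel m p \<epsilon> \<delta> s x =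
     bucket_select sel m (A_D p \<epsilon> \<delta>) (A_R p \<epsilon> \<delta>) (main_hash s) (group_hash s) (bs_sign s) x"

definition A_candidates ::
  "((nat \<Rightarrow> real) \<Rightarrow> nat set) \<Rightarrow> (nat set \<Rightarrow> nat \<Rightarrow> nat) \<Rightarrow> nat \<Rightarrow> real \<Rightarrow> real \<Rightarrow> real \<Rightarrow> seed \<Rightarrow>
   vec \<Rightarrow> nat set" where
  "A_candidates sel hstar m p \<epsilon> \<delta> s x =
     (\<Union>d\<in>A_select sel m p \<epsilon> \<delta> s x.
        spot hstar m (A_alpha p \<epsilon> \<delta>) (spot_hash s d) (spot_sign s d) x (bucket m (main_hash s) d))"

definition A_output ::
  "((nat \<Rightarrow> real) \<Rightarrow> nat set) \<Rightarrow> (nat set \<Rightarrow> nat \<Rightarrow> nat) \<Rightarrow> nat \<Rightarrow> real \<Rightarrow> real \<Rightarrow> real \<Rightarrow> seed \<Rightarrow>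
   vec \<Rightarrow> vec" where
  "A_output sel hstar m p \<epsilon> \<delta> s x =
     (\<lambda>i. if i \<in> A_candidates sel hstar m p \<epsilon> \<delta> s x then x i else 0)"

text \<open>The list of all functionals that the algorithm evaluates on input \<open>x\<close>.\<close>

definition A_queries ::
  "((nat \<Rightarrow> real) \<Rightarrow> nat set) \<Rightarrow> (nat set \<Rightarrow> nat \<Rightarrow> nat) \<Rightarrow> nat \<Rightarrow> real \<Rightarrow> real \<Rightarrow> real \<Rightarrow> seed \<Rightarrow>
   vec \<Rightarrow> (vec \<Rightarrow> real) list" where
  "A_queries sel hstar m p \<epsilon> \<delta> s x =
     [bs_meas m (A_D p \<epsilon> \<delta>) (main_hash s) (group_hash s r) (bs_sign s r) g.
        r \<leftarrow> [1..<Suc (A_R p \<epsilon> \<delta>)], g \<leftarrow> [1..<Suc (A_G p \<epsilon>)]] @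
     concat (map (\<lambda>d. spot_queries hstar m (A_alpha p \<epsilon> \<delta>) (spot_hash s d) (spot_sign s d) x
                        (bucket m (main_hash s) d))
       (sorted_list_of_set (A_select sel m p \<epsilon> \<delta> s x))) @
     map (\<lambda>i y. y i) (sorted_list_of_set (A_candidates sel hstar m p \<epsilon> \<delta> s x))"

definition A_card ::
  "((nat \<Rightarrow> real) \<Rightarrow> nat set) \<Rightarrow> (nat set \<Rightarrow> nat \<Rightarrow> nat) \<Rightarrow> seed pmf \<Rightarrow> nat \<Rightarrow> real \<Rightarrow> real \<Rightarrow> real \<Rightarrow>
   enat" where
  "A_card sel hstar P m p \<epsilon> \<delta> =
     (SUP s\<in>set_pmf P. SUP x. enat (length (A_queries sel hstar m p \<epsilon> \<delta> s x)))"

end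

theory Submission
  imports Defs
begin

text \<open>
  A coordinate outside the output set \<open>K\<close> matters only if it is larger than \<open>\<epsilon>\<close> in absolute value,
  and there are at most \<open>k\<^sub>0\<close> such coordinates. By Markov's inequality the hash vector \<open>H\<close> puts
  each of them into a bucket whose remaining \<open>\<ell>\<^sub>p\<close>-mass is at most \<open>\<epsilon>/\<gamma>\<close>, up to probability
  \<open>\<delta>/4\<close>. Condition on such an \<open>H\<close>.

  In BucketSelect at most \<open>k\<close> buckets have norm above \<open>2\<^sup>-\<^sup>7\<^sup>/\<^sup>2 \<epsilon>\<close>. For a light bucket, and for a
  bucket with an important coordinate \<open>i\<close>, the noise in one repetition (everything but \<open>x\<^sub>i\<close>) exceeds
  \<open>\<epsilon>/2\<close> with probability at most \<open>1/8\<close>: large colliding coordinates are treated by counting and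
  small ones by Chebyshev's inequality. Taking medians makes the important buckets beat all the
  light ones, so they are selected, up to probability \<open>\<delta>/4\<close>.

  In Spot, the set \<open>S\<^sub>k\<close> reached without failure depends on the hash vectors only, so Chebyshev's
  inequality applies to the signs of step \<open>k\<close> even if these are shared between the steps. The
  failure probability of step \<open>k\<close> is of order \<open>D\<^sub>k\<^sup>2 / (D\<^sub>0 \<cdots> D\<^sub>k\<^sub>-\<^sub>1)\<close>, which decays
  geometrically, with sum at most \<open>\<alpha> = \<delta>/(2 k\<^sub>0)\<close> by the choice of \<open>\<gamma>\<close>.
\<close>

section \<open>Conditioning and random signs\<close>

lemma uniform_rv_in:
  assumes "uniform_rv P X A" "finite A" "A \<noteq> {}" "s \<in> set_pmf P"
  shows "X s \<in> A"
proof -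
  have "set_pmf (map_pmf X P) = A"
    using assms by (simp add: uniform_rv_def set_pmf_of_set)
  then show ?thesis using assms(4) by auto
qed

lemma uniform_rv_prob:
  assumes "uniform_rv P X A" "finite A" "a \<in> A"
  shows "measure_pmf.prob P (X -` {a}) = 1 / card A"
proof -
  have "measure_pmf.prob P (X -` {a}) = pmf (map_pmf X P) a"
    by (simp add: pmf_map)
  also have "\<dots> = 1 / card A"
    using assms by (subst assms(1)[unfolded uniform_rv_def], subst pmf_of_set) auto
  finally show ?thesis .
qed

lemma map_pmf_indep_pair:
  assumes "indep_pair P X Y"
  shows "map_pmf (\<lambda>s. (X s, Y s)) P = pair_pmf (map_pmf X P) (map_pmf Y P)"
proof (rule pmf_eqI, safe)
  fix a b
  have "measure_pmf.prob P (X -` {a} \<inter> Y -` {b})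
          = measure_pmf.prob P (X -` {a}) * measure_pmf.prob P (Y -` {b})"
    using assms unfolding indep_pair_def by (rule prob_space.indep_setD[OF prob_space_measure_pmf]) auto
  moreover have "(\<lambda>s. (X s, Y s)) -` {(a, b)} = X -` {a} \<inter> Y -` {b}" by auto
  ultimately show "pmf (map_pmf (\<lambda>s. (X s, Y s)) P) (a, b)
      = pmf (pair_pmf (map_pmf X P) (map_pmf Y P)) (a, b)"
    by (simp add: pmf_map pmf_pair)
qed

text \<open>Fubini for the product law of \<open>X\<close> and \<open>Y\<close>: the value of
  \<open>X\<close> is frozen, the probability is taken over \<open>Y\<close> alone, and the
  resulting bound is averaged over \<open>X\<close>. This takes the place of conditional
  probabilities.\<close>

lemma indep_pair_prob_le:
  fixes g :: "'a \<Rightarrow> real"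
  assumes ind: "indep_pair P X Y"
    and le: "\<And>s. s \<in> set_pmf P \<Longrightarrow> measure_pmf.prob P {t. F (X s) (Y t)} \<le> g (X s)"
    and int: "integrable (measure_pmf P) (\<lambda>s. g (X s))"
  shows "measure_pmf.prob P {s. F (X s) (Y s)} \<le> measure_pmf.expectation P (\<lambda>s. g (X s))"
proof -
  let ?A = "map_pmf X P" and ?B = "map_pmf Y P" and ?S = "{(a, b). F a b}"
  have nonneg: "0 \<le> g (X s)" if "s \<in> set_pmf P" for s
    using le[OF that] measure_nonneg order_trans by blast
  have "emeasure (measure_pmf P) {s. F (X s) (Y s)}
          = emeasure (measure_pmf (map_pmf (\<lambda>s. (X s, Y s)) P)) ?S"
    by simp
  also have "\<dots> = emeasure (measure_pmf (pair_pmf ?A ?B)) ?S"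
    by (simp only: map_pmf_indep_pair[OF ind])
  also have "\<dots> = (\<integral>\<^sup>+z. indicator ?S z \<partial>pair_pmf ?A ?B)"
    by simp
  also have "\<dots> = (\<integral>\<^sup>+a. \<integral>\<^sup>+b. indicator ?S (a, b) \<partial>?B \<partial>?A)"
    by (rule nn_integral_pair_pmf')
  also have "\<dots> = (\<integral>\<^sup>+s. \<integral>\<^sup>+t. indicator ?S (X s, Y t) \<partial>P \<partial>P)"
    by simp
  also have "\<dots> = (\<integral>\<^sup>+s. emeasure (measure_pmf P) {t. F (X s) (Y t)} \<partial>P)"
  proof (rule nn_integral_cong)
    fix s
    have "(\<lambda>t. indicator ?S (X s, Y t)) = (indicator {t. F (X s) (Y t)} :: _ \<Rightarrow> ennreal)"
      by (auto simp: indicator_def)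
    then show "(\<integral>\<^sup>+t. indicator ?S (X s, Y t) \<partial>P) = emeasure (measure_pmf P) {t. F (X s) (Y t)}"
      by simp
  qed
  also have "\<dots> \<le> (\<integral>\<^sup>+s. ennreal (g (X s)) \<partial>P)"
    using le by (intro nn_integral_mono_AE AE_pmfI)
      (auto simp: measure_pmf.emeasure_eq_measure intro!: ennreal_leI)
  also have "\<dots> = ennreal (measure_pmf.expectation P (\<lambda>s. g (X s)))"
    using int nonneg by (intro nn_integral_eq_integral AE_pmfI) auto
  finally show ?thesis
    using nonneg by (simp add: measure_pmf.emeasure_eq_measure integral_nonneg_AE AE_measure_pmf_iff)
qed

text \<open>The event \<open>Q (X s)\<close> may be assumed while \<open>Y\<close> is averaged. The
  bound is for the joint event, so no division by the probability of \<open>Q\<close>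
  occurs.\<close>

lemma indep_pair_prob_le_const:
  assumes ind: "indep_pair P X Y" and "0 \<le> c"
    and le: "\<And>s. s \<in> set_pmf P \<Longrightarrow> Q (X s) \<Longrightarrow> measure_pmf.prob P {t. F (X s) (Y t)} \<le> c"
  shows "measure_pmf.prob P {s. Q (X s) \<and> F (X s) (Y s)} \<le> c"
proof -
  have "measure_pmf.prob P {t. Q (X s) \<and> F (X s) (Y t)} \<le> c" if "s \<in> set_pmf P" for s
    \<comment> \<open>Where \<open>Q\<close> fails the event is empty; this case uses
      \<open>0 \<le> c\<close>.\<close>
    using le[OF that] \<open>0 \<le> c\<close> by (cases "Q (X s)") auto
  then have "measure_pmf.prob P {s. Q (X s) \<and> F (X s) (Y s)} \<le> measure_pmf.expectation P (\<lambda>s. c)"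
    by (rule indep_pair_prob_le[OF ind]) auto
  then show ?thesis by simp
qed

lemma indep_var_pair_prob:
  assumes "prob_space.indep_var (measure_pmf P) (count_space UNIV) X (count_space UNIV) Y"
  shows "measure_pmf.prob P (X -` A \<inter> Y -` B)
           = measure_pmf.prob P (X -` A) * measure_pmf.prob P (Y -` B)"
proof -
  have "(\<lambda>x. (X x, Y x)) -` (A \<times> B) = X -` A \<inter> Y -` B" by auto
  then show ?thesis
    using prob_space.indep_varD[OF prob_space_measure_pmf assms, of A B] by simp
qed

text \<open>Each of the \<open>card A\<close> possible common values is attained with probability
  \<open>1 / (card A)\<^sup>2\<close>. The form with two variables fits pairwise independent hash
  values.\<close>

lemma prob_collision:
  fixes X Y :: "'s \<Rightarrow> 'a"
  assumes ind: "prob_space.indep_var (measure_pmf P) (count_space UNIV) X (count_space UNIV) Y"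
    and X: "uniform_rv P X A" and Y: "uniform_rv P Y A" and A: "finite A" "A \<noteq> {}"
  shows "measure_pmf.prob P {s. X s = Y s} = 1 / card A"
proof -
  \<comment> \<open>Values outside \<open>A\<close> occur only off the support of \<open>P\<close>,
    so the two events agree almost surely.\<close>
  have "measure_pmf.prob P {s. X s = Y s} = measure_pmf.prob P (\<Union>a\<in>A. X -` {a} \<inter> Y -` {a})"
    by (rule measure_pmf.finite_measure_eq_AE)
      (use uniform_rv_in[OF X A] in \<open>auto simp: AE_measure_pmf_iff\<close>)
  also have "\<dots> = (\<Sum>a\<in>A. measure_pmf.prob P (X -` {a} \<inter> Y -` {a}))"
    by (rule measure_pmf.finite_measure_finite_Union)
      (use A in \<open>auto simp: disjoint_family_on_def\<close>)
  also have "\<dots> = (\<Sum>a\<in>A. 1 / card A * (1 / card A))"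
    by (intro sum.cong refl)
      (simp add: indep_var_pair_prob[OF ind] uniform_rv_prob[OF X A(1)] uniform_rv_prob[OF Y A(1)])
  also have "\<dots> = 1 / card A" using A by simp
  finally show ?thesis .
qed

section \<open>Second moments and tails of random sign sums\<close>

lemma expectation_uniform_sign:
  fixes X :: "'s \<Rightarrow> real"
  assumes "uniform_rv P X {-1, 1}"
  shows "measure_pmf.expectation P X = 0"
proof -
  have "measure_pmf.expectation P X = measure_pmf.expectation (map_pmf X P) (\<lambda>y. y)"
    by simp
  also have "\<dots> = measure_pmf.expectation (pmf_of_set {-1, 1 :: real}) (\<lambda>y. y)"
    using assms by (simp add: uniform_rv_def)
  also have "\<dots> = 0"
    by (subst integral_pmf_of_set) auto
  finally show ?thesis .
qed

lemma uniform_sign_cases: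
  fixes X :: "'s \<Rightarrow> real"
  assumes "uniform_rv P X {-1, 1}" "s \<in> set_pmf P"
  shows "X s = -1 \<or> X s = 1"
  using uniform_rv_in[OF assms(1) _ _ assms(2)] by auto

lemma integrable_pmf_bounded:
  fixes f :: "'s \<Rightarrow> real"
  assumes "\<And>s. s \<in> set_pmf P \<Longrightarrow> \<bar>f s\<bar> \<le> B"
  shows "integrable (measure_pmf P) f"
  by (rule measure_pmf.integrable_const_bound[where B=B])
    (use assms in \<open>auto simp: AE_measure_pmf_iff\<close>)

text \<open>Products of two distinct signs have mean zero by independence, and squared signs are 1
  on the support, so only the diagonal of the expanded square remains.\<close>

lemma sign_sum_second_moment:
  fixes X :: "'i \<Rightarrow> 's \<Rightarrow> real"
  assumes A: "finite A" and u: "\<And>i. i \<in> A \<Longrightarrow> uniform_rv P (X i) {-1, 1}"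
    and ind: "pairwise_indep P X A"
  shows "measure_pmf.expectation P (\<lambda>s. (\<Sum>i\<in>A. w i * X i s)\<^sup>2) = (\<Sum>i\<in>A. (w i)\<^sup>2)"
proof -
  have bnd: "\<bar>X i s\<bar> \<le> 1" if "i \<in> A" "s \<in> set_pmf P" for i s
    using uniform_sign_cases[OF u[OF that(1)] that(2)] by auto
  have int1: "integrable (measure_pmf P) (X i)" if "i \<in> A" for i
    using bnd[OF that] by (intro integrable_pmf_bounded) auto
  have int2: "integrable (measure_pmf P) (\<lambda>s. X i s * X j s)" if "i \<in> A" "j \<in> A" for i j
    using bnd[OF that(1)] bnd[OF that(2)]
    by (intro integrable_pmf_bounded[where B=1]) (auto simp: abs_mult intro!: mult_le_one)
  have E: "measure_pmf.expectation P (\<lambda>s. X i s * X j s) = (if i = j then 1 else 0)"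
    if "i \<in> A" "j \<in> A" for i j
  proof (cases "i = j")
    case True
    have "measure_pmf.expectation P (\<lambda>s. X i s * X j s) = measure_pmf.expectation P (\<lambda>s. 1)"
      by (rule integral_cong_AE)
        (use True uniform_sign_cases[OF u[OF that(1)]] in \<open>fastforce simp: AE_measure_pmf_iff\<close>)+
    then show ?thesis using True by simp
  next
    case False
    then have "prob_space.indep_var (measure_pmf P) (count_space UNIV) (X i) (count_space UNIV) (X j)"
      using ind that by (auto simp: pairwise_indep_def)
    then have "prob_space.indep_var (measure_pmf P) borel ((\<lambda>y. y) \<circ> X i) borel ((\<lambda>y. y) \<circ> X j)"
      by (rule prob_space.indep_var_compose[OF prob_space_measure_pmf]) auto
    then have "prob_space.indep_var (measure_pmf P) borel (X i) borel (X j)"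
      by (simp add: comp_def)
    from prob_space.indep_var_lebesgue_integral[OF prob_space_measure_pmf this int1[OF that(1)] int1[OF that(2)]]
    show ?thesis using False expectation_uniform_sign[OF u[OF that(1)]] by simp
  qed
  have "measure_pmf.expectation P (\<lambda>s. (\<Sum>i\<in>A. w i * X i s)\<^sup>2)
      = measure_pmf.expectation P (\<lambda>s. \<Sum>i\<in>A. \<Sum>j\<in>A. (w i * w j) * (X i s * X j s))"
    by (intro Bochner_Integration.integral_cong refl)
      (simp add: power2_eq_square sum_product mult_ac)
  also have "\<dots> = (\<Sum>i\<in>A. \<Sum>j\<in>A. (w i * w j) * measure_pmf.expectation P (\<lambda>s. X i s * X j s))"
  proof -
    have "measure_pmf.expectation P (\<lambda>s. \<Sum>i\<in>A. \<Sum>j\<in>A. (w i * w j) * (X i s * X j s))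
        = (\<Sum>i\<in>A. measure_pmf.expectation P (\<lambda>s. \<Sum>j\<in>A. (w i * w j) * (X i s * X j s)))"
      by (intro Bochner_Integration.integral_sum Bochner_Integration.integrable_sum
          integrable_mult_right int2)
    also have "\<dots> = (\<Sum>i\<in>A. \<Sum>j\<in>A.
        measure_pmf.expectation P (\<lambda>s. (w i * w j) * (X i s * X j s)))"
      by (intro sum.cong refl Bochner_Integration.integral_sum integrable_mult_right int2)
    finally show ?thesis by simp
  qed
  also have "\<dots> = (\<Sum>i\<in>A. \<Sum>j\<in>A. if i = j then (w i)\<^sup>2 else 0)"
    by (intro sum.cong refl) (auto simp: E power2_eq_square)
  also have "\<dots> = (\<Sum>i\<in>A. (w i)\<^sup>2)"
    using A by simp
  finally show ?thesis .
qed

lemma pmf_markov: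
  fixes Z :: "'s \<Rightarrow> real"
  assumes "0 < t" and nn: "\<And>s. s \<in> set_pmf P \<Longrightarrow> 0 \<le> Z s" and int: "integrable (measure_pmf P) Z"
  shows "measure_pmf.prob P {s. t \<le> Z s} \<le> measure_pmf.expectation P Z / t"
  using integral_Markov_inequality_measure[OF int, of UNIV t] assms
  by (auto simp: AE_measure_pmf_iff)

text \<open>Chebyshev's inequality, as Markov's inequality for the squared sum.\<close>

lemma sign_sum_tail:
  fixes X :: "'i \<Rightarrow> 's \<Rightarrow> real"
  assumes A: "finite A" and u: "\<And>i. i \<in> A \<Longrightarrow> uniform_rv P (X i) {-1, 1}"
    and ind: "pairwise_indep P X A" and t: "0 < t"
  shows "measure_pmf.prob P {s. t \<le> \<bar>\<Sum>i\<in>A. w i * X i s\<bar>} \<le> (\<Sum>i\<in>A. (w i)\<^sup>2) / t\<^sup>2"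
proof -
  let ?Z = "\<lambda>s. (\<Sum>i\<in>A. w i * X i s)\<^sup>2"
  have "\<bar>?Z s\<bar> \<le> (\<Sum>i\<in>A. \<bar>w i\<bar>)\<^sup>2" if "s \<in> set_pmf P" for s
  proof -
    have "\<bar>\<Sum>i\<in>A. w i * X i s\<bar> \<le> (\<Sum>i\<in>A. \<bar>w i\<bar>)"
    proof (rule order_trans[OF sum_abs sum_mono])
      fix i assume "i \<in> A"
      then show "\<bar>w i * X i s\<bar> \<le> \<bar>w i\<bar>"
        using uniform_sign_cases[OF u that, of i] by auto
    qed
    then show ?thesis by (simp add: abs_le_square_iff[symmetric])
  qed
  then have int: "integrable (measure_pmf P) ?Z" by (rule integrable_pmf_bounded)
  have "{s. t \<le> \<bar>\<Sum>i\<in>A. w i * X i s\<bar>} = {s. t\<^sup>2 \<le> ?Z s}"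
    using t by (auto simp: abs_le_square_iff[symmetric])
  then show ?thesis
    using pmf_markov[of "t\<^sup>2" P ?Z] int t sign_sum_second_moment[OF A u ind, of w] by simp
qed

lemma pairwise_indep_subset: "pairwise_indep P X I \<Longrightarrow> J \<subseteq> I \<Longrightarrow> pairwise_indep P X J"
  by (auto simp: pairwise_indep_def)

lemma indep_family_pairwise:
  assumes ind: "indep_family P X I"
  shows "pairwise_indep P X I"
  unfolding pairwise_indep_def
proof (intro ballI impI)
  fix i j assume ij: "i \<in> I" "j \<in> I" "i \<noteq> j"
  show "prob_space.indep_var (measure_pmf P) (count_space UNIV) (X i) (count_space UNIV) (X j)"
  proof -
    \<comment> \<open>The restrictions to the disjoint blocks \<open>{i}\<close> and
      \<open>{j}\<close> are independent; composing with the coordinate projections recovers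
      \<open>X i\<close> and \<open>X j\<close>.\<close>
    have "prob_space.indep_var (measure_pmf P)
        (count_space UNIV) ((\<lambda>f. f i) \<circ> (\<lambda>\<omega>. restrict (\<lambda>i. X i \<omega>) {i}))
        (count_space UNIV) ((\<lambda>f. f j) \<circ> (\<lambda>\<omega>. restrict (\<lambda>i. X i \<omega>) {j}))"
      using ij by (intro prob_space.indep_var_compose[OF prob_space_measure_pmf
            prob_space.indep_var_restrict[OF prob_space_measure_pmf ind[unfolded indep_family_def]]]
          measurable_component_singleton) auto
    then show ?thesis by (simp add: comp_def)
  qed
qed

section \<open>Spot\<close>

text \<open>Recentring the second measurement at \<open>h i\<close> leaves pure noise, so the
  quotient of the measurements reveals \<open>h i\<close> up to an error below 1/2. The bound
  \<open>N1\<close> keeps the first measurement above 9/10 of \<open>\<bar>x i\<bar>\<close> in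
  absolute value, and 9/20 is half of that.\<close>

lemma shrink_contains:
  fixes x :: vec and h :: "nat \<Rightarrow> nat"
  assumes S: "finite S" "i \<in> S" and \<sigma>: "\<bar>\<sigma> i\<bar> = 1"
    and N1: "\<bar>\<Sum>j\<in>S - {i}. x j * \<sigma> j\<bar> < \<bar>x i\<bar> / 10"
    and N2: "\<bar>\<Sum>j\<in>S - {i}. ((real (h j) - real (h i)) * x j) * \<sigma> j\<bar> < 9 / 20 * \<bar>x i\<bar>"
  shows "shrink D h \<sigma> x S = {j \<in> S. h j = h i}"
proof -
  let ?N1 = "\<Sum>j\<in>S - {i}. x j * \<sigma> j"
  let ?N2 = "\<Sum>j\<in>S - {i}. ((real (h j) - real (h i)) * x j) * \<sigma> j"
  let ?c = "(real D + 1) / 2"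
  let ?Y1 = "shrink_meas1 \<sigma> S x" and ?Y2 = "shrink_meas2 D h \<sigma> S x"
  have Y1: "?Y1 = \<sigma> i * x i + ?N1"
    unfolding shrink_meas1_def using S by (subst sum.remove[of S i]) (auto simp: mult.commute)
  have "?Y2 - (real (h i) - ?c) * ?Y1 = (\<Sum>j\<in>S. ((real (h j) - real (h i)) * x j) * \<sigma> j)"
    unfolding shrink_meas1_def shrink_meas2_def sum_distrib_left sum_subtractf[symmetric]
    by (intro sum.cong refl) (simp add: algebra_simps)
  also have "\<dots> = ?N2"
    using S by (subst sum.remove[of S i]) auto
  finally have Y2: "?Y2 = (real (h i) - ?c) * ?Y1 + ?N2" by simp
  have "\<bar>\<sigma> i * x i\<bar> = \<bar>x i\<bar>" using \<sigma> by (simp add: abs_mult)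
  then have big: "9 / 10 * \<bar>x i\<bar> < \<bar>?Y1\<bar>" using Y1 N1 by linarith
  then have nz: "?Y1 \<noteq> 0" and lt: "\<bar>?N2\<bar> < 1 / 2 * \<bar>?Y1\<bar>" using N2 by auto
  then have "\<bar>?N2\<bar> / \<bar>?Y1\<bar> < 1 / 2" by (subst pos_divide_less_eq) auto
  then have "\<bar>?N2 / ?Y1\<bar> < 1 / 2" by (simp only: abs_divide)
  then have e: "- (1 / 2) < ?N2 / ?Y1" "?N2 / ?Y1 < 1 / 2" by (simp_all only: abs_less_iff, linarith+)
  \<comment> \<open>Since \<open>?c\<close> exceeds \<open>real D / 2\<close> by 1/2, the argument
    of the ceiling lies strictly between \<open>h i - 1\<close> and \<open>h i\<close>.\<close>
  have "?Y2 / ?Y1 + real D / 2 = real (h i) + (?N2 / ?Y1 - 1 / 2)"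
    using nz unfolding Y2 by (simp add: field_simps)
  moreover have "\<lceil>real (h i) + (?N2 / ?Y1 - 1 / 2)\<rceil> = int (h i)"
    using e by (intro ceiling_unique) linarith+
  ultimately have "\<lceil>?Y2 / ?Y1 + real D / 2\<rceil> = int (h i)" by simp
  then show ?thesis using nz by (auto simp: shrink_def)
qed

text \<open>
  If all steps up to \<open>k\<close> succeed, then \<open>S\<^sub>k\<close> is the following set, which does not depend on the
  signs. This decouples the steps although they may share their signs.
\<close>

definition ideal_set :: "(nat \<Rightarrow> nat \<Rightarrow> nat) \<Rightarrow> nat set \<Rightarrow> nat \<Rightarrow> nat \<Rightarrow> nat set" where
  "ideal_set H J i k = {j \<in> J. \<forall>l<k. H l j = H l i}"

text \<open>Formulated with \<open>ideal_set\<close> instead of the set actually reached, so that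
  for fixed hash vectors the event depends on the signs of step \<open>k\<close> only. The disjunct
  on \<open>\<bar>\<sigma> k i\<bar>\<close> has probability zero; including it lets
  \<open>spot_contains\<close> be stated for arbitrary real values of the signs.\<close>

definition spot_bad ::
  "(nat set \<Rightarrow> nat \<Rightarrow> nat) \<Rightarrow> nat \<Rightarrow> vec \<Rightarrow> nat set \<Rightarrow> nat \<Rightarrow> nat \<Rightarrow> (nat \<Rightarrow> nat \<Rightarrow> nat) \<Rightarrow>
   (nat \<Rightarrow> nat \<Rightarrow> real) \<Rightarrow> bool" where
  "spot_bad hstar m x J i k H \<sigma> \<longleftrightarrow>
     (let S = ideal_set H J i k; h = step_hash hstar m H k S in
      \<bar>\<sigma> k i\<bar> \<noteq> 1 \<or>
      \<bar>x i\<bar> / 10 \<le> \<bar>\<Sum>j\<in>S - {i}. x j * \<sigma> k j\<bar> \<or>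
      9 / 20 * \<bar>x i\<bar> \<le> \<bar>\<Sum>j\<in>S - {i}. ((real (h j) - real (h i)) * x j) * \<sigma> k j\<bar>)"

text \<open>The deterministic half of the analysis: without bad steps the set reached is the ideal
  set, by induction, and this always contains \<open>i\<close>. The final step with
  \<open>hstar\<close> keeps \<open>i\<close> as well, because \<open>shrink_contains\<close> holds
  for every hash vector.\<close>

lemma spot_contains:
  assumes J: "finite J" "i \<in> J"
    and good: "\<And>k. k \<le> spot_steps m \<Longrightarrow> \<not> spot_bad hstar m x J i k H \<sigma>"
  shows "i \<in> spot hstar m \<alpha> H \<sigma> x J"
proof -
  let ?S = "spot_set hstar m \<alpha> H \<sigma> x J"
  have fin: "finite (ideal_set H J i k)" and mem: "i \<in> ideal_set H J i k" for k
    using J by (auto simp: ideal_set_def)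
  have step: "shrink D (step_hash hstar m H k S) (\<sigma> k) x S
      = {j \<in> S. step_hash hstar m H k S j = step_hash hstar m H k S i}"
    if "k \<le> spot_steps m" "S = ideal_set H J i k" for k D S
    using good[OF that(1)] that fin mem
    by (intro shrink_contains) (auto simp: spot_bad_def Let_def)
  have eq: "?S k = ideal_set H J i k" if "k \<le> spot_steps m" for k
    using that
  proof (induction k)
    case 0
    then show ?case by (simp add: ideal_set_def)
  next
    case (Suc k)
    let ?I = "ideal_set H J i k"
    have IH: "?S k = ?I" and k: "k < spot_steps m" using Suc by auto
    have next_set: "ideal_set H J i (Suc k) = {j \<in> ?I. H k j = H k i}"
      by (auto simp: ideal_set_def less_Suc_eq)
    show ?case
    proof (cases "card ?I > 1")
      case True
      then show ?thesis
        using step[of k ?I] k by (simp add: IH next_set Let_def step_hash_def)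
    next
      \<comment> \<open>Spot has stopped. The ideal set is then \<open>{i}\<close> and remains so,
        hence the two sequences still agree.\<close>
      case False
      then have "?I = {i}"
        using fin[of k] mem[of k] by (metis card_le_Suc0_iff_eq is_singletonI' is_singleton_the_elem
            One_nat_def not_less singletonD empty_iff)
      then show ?thesis by (auto simp: IH next_set)
    qed
  qed
  show ?thesis
    unfolding spot_def using eq[of "spot_steps m"] mem[of "spot_steps m"]
      step[of "spot_steps m" "ideal_set H J i (spot_steps m)"]
    by (auto simp: Let_def)
qed

section \<open>Output size and number of queries of Spot\<close>

lemma spot_set_subset: "spot_set hstar m \<alpha> H \<sigma> x J k \<subseteq> J"
  by (induction k) (auto simp: Let_def shrink_def)

text \<open>Whatever the signs do, the last shrinking keeps only coordinates with one common value
  of the injective \<open>hstar\<close>. The bound covers failed runs too, as the worst-case cost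
  requires.\<close>

lemma card_spot_le:
  assumes "injection_rule hstar" "finite J"
  shows "card (spot hstar m \<alpha> H \<sigma> x J) \<le> 1"
proof -
  let ?S = "spot_set hstar m \<alpha> H \<sigma> x J (spot_steps m)"
  have fin: "finite ?S" using spot_set_subset assms(2) finite_subset by metis
  show ?thesis
  proof (cases "card ?S > 1")
    case False
    then show ?thesis by (simp add: spot_def Let_def)
  next
    case True
    have "inj_on (hstar ?S) ?S" using assms(1) fin by (auto simp: injection_rule_def)
    moreover have "spot hstar m \<alpha> H \<sigma> x J
        = shrink (step_range m \<alpha> (spot_steps m) ?S) (hstar ?S) (\<sigma> (spot_steps m)) x ?S"
      using True by (simp add: spot_def Let_def step_hash_def)
    ultimately have "\<And>a b. a \<in> spot hstar m \<alpha> H \<sigma> x J \<Longrightarrow> b \<in> spot hstar m \<alpha> H \<sigma> x J \<Longrightarrow> a = b"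
      by (auto simp: shrink_def inj_on_def split: if_splits)
    moreover have "finite (spot hstar m \<alpha> H \<sigma> x J)"
      unfolding spot_def using spot_set_subset assms(2) finite_subset by metis
    ultimately show ?thesis
      by (metis card_le_Suc0_iff_eq One_nat_def)
  qed
qed

lemma length_spot_queries:
  "length (spot_queries hstar m \<alpha> H \<sigma> x J) \<le> 2 * Suc (spot_steps m)"
proof -
  let ?f = "\<lambda>k. let S = spot_set hstar m \<alpha> H \<sigma> x J k in
                      if card S > 1
                      then [shrink_meas1 (\<sigma> k) S,
                            shrink_meas2 (step_range m \<alpha> k S) (step_hash hstar m H k S) (\<sigma> k) S]
                      else []"
  have "length (spot_queries hstar m \<alpha> H \<sigma> x J) = (\<Sum>k\<leftarrow>[0..<Suc (spot_steps m)]. length (?f k))"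
    by (simp add: spot_queries_def length_concat comp_def)
  also have "\<dots> \<le> (\<Sum>k\<leftarrow>[0..<Suc (spot_steps m)]. 2)"
    by (intro sum_list_mono) (auto simp: Let_def)
  also have "\<dots> = 2 * Suc (spot_steps m)" by (simp add: sum_list_triv)
  finally show ?thesis .
qed

section \<open>Failure probability of one shrinking step\<close>

text \<open>Within one step pairwise independence gives the collision probability, and the hash
  vectors of distinct steps are independent, so the probabilities multiply.\<close>

lemma spot_ideal_prob:
  assumes law: "spot_law m \<alpha> d P" and k: "k \<le> spot_steps m"
    and ij: "i \<in> {1..m}" "j \<in> {1..m}" "i \<noteq> j"
    and pos: "\<And>l. 0 < spot_range \<alpha> l"
  shows "measure_pmf.prob P {s. \<forall>l<k. spot_hashes m d s l j = spot_hashes m d s l i}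
           = (\<Prod>l<k. 1 / real (spot_range \<alpha> l))"
\<comment> \<open>The product rule for independent events asks for a nonempty index set; for
  \<open>k = 0\<close> both sides are 1.\<close>
proof (cases "k = 0")
  case False
  let ?X = "\<lambda>l s. spot_hashes m d s l" and ?E = "{f :: nat \<Rightarrow> nat. f j = f i}"
  have ind: "indep_family P ?X {..<spot_steps m}"
    using law by (simp add: spot_law_def)
  have "measure_pmf.prob P {s. \<forall>l<k. ?X l s j = ?X l s i}
      = measure_pmf.prob P (\<Inter>l\<in>{..<k}. ?X l -` ?E \<inter> space (measure_pmf P))"
    using False by (intro arg_cong[where f="measure_pmf.prob P"]) auto
  also have "\<dots> = (\<Prod>l\<in>{..<k}. measure_pmf.prob P (?X l -` ?E \<inter> space (measure_pmf P)))"
    by (rule prob_space.indep_varsD[OF prob_space_measure_pmf ind[unfolded indep_family_def]])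
      (use False k in auto)
  also have "\<dots> = (\<Prod>l<k. 1 / real (spot_range \<alpha> l))"
  proof (rule prod.cong[OF refl])
    fix l assume "l \<in> {..<k}"
    then have l: "l < spot_steps m" using k by auto
    have u: "uniform_rv P (\<lambda>s. ?X l s a) {1..spot_range \<alpha> l}" if "a \<in> {1..m}" for a
      using law l that by (auto simp: spot_law_def)
    have "prob_space.indep_var (measure_pmf P) (count_space UNIV) (\<lambda>s. ?X l s j)
        (count_space UNIV) (\<lambda>s. ?X l s i)"
      using law l ij by (auto simp: spot_law_def pairwise_indep_def)
    from prob_collision[OF this u[OF ij(2)] u[OF ij(1)]] pos[of l]
    show "measure_pmf.prob P (?X l -` ?E \<inter> space (measure_pmf P)) = 1 / real (spot_range \<alpha> l)"
      by (simp add: vimage_def)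
  qed
  finally show ?thesis .
qed auto

text \<open>For frozen hash vectors, Chebyshev's inequality for the signs of step \<open>k\<close>
  bounds both noise sums; 100 and 400/81 are the inverse squares of the thresholds 1/10 and 9/20,
  and \<open>B\<close> bounds all hash differences, also those of the final injective hash.
  Averaging over the hash vectors then weights each \<open>j\<close> with its probability of
  surviving up to step \<open>k\<close>.\<close>

lemma spot_step_prob:
  fixes x :: vec
  assumes law: "spot_law m \<alpha> d P" and inj: "injection_rule hstar" and k: "k \<le> spot_steps m"
    and J: "J \<subseteq> {1..m}" "i \<in> J" and xi: "x i \<noteq> 0"
    and pos: "\<And>l. 0 < spot_range \<alpha> l"
    and B: "k < spot_steps m \<Longrightarrow> real (spot_range \<alpha> k) \<le> B" "k = spot_steps m \<Longrightarrow> real m \<le> B"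
  shows "measure_pmf.prob P {s. spot_bad hstar m x J i k (spot_hashes m d s) (spot_signs m d s)}
           \<le> (100 + 400 / 81 * B\<^sup>2) / (x i)\<^sup>2 * (\<Prod>l<k. 1 / real (spot_range \<alpha> l))
               * (\<Sum>j\<in>J - {i}. (x j)\<^sup>2)"
proof -
  let ?c = "(100 + 400 / 81 * B\<^sup>2) / (x i)\<^sup>2"
  let ?g = "\<lambda>u. \<Sum>j\<in>J - {i}. ?c * (x j)\<^sup>2 * of_bool (j \<in> ideal_set u J i k)"
  have fJ: "finite J" using J finite_subset by blast
  have indS: "indep_pair P (spot_hashes m d) (spot_signs m d)"
    using law by (simp add: spot_law_def)
  have us: "uniform_rv P (\<lambda>s. spot_signs m d s k a) {-1, 1}" if "a \<in> {1..m}" for a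
    using law k that by (auto simp: spot_law_def)
  have ps: "pairwise_indep P (\<lambda>a s. spot_signs m d s k a) {1..m}"
    using law k by (auto simp: spot_law_def)
  have int: "integrable (measure_pmf P) (\<lambda>s. of_bool (Q s) :: real)" for Q
    by (rule integrable_pmf_bounded[where B=1]) auto
  have le: "measure_pmf.prob P {t. spot_bad hstar m x J i k (spot_hashes m d s) (spot_signs m d t)}
      \<le> ?g (spot_hashes m d s)" if s: "s \<in> set_pmf P" for s
  proof -
    define S where "S = ideal_set (spot_hashes m d s) J i k"
    define h where "h = step_hash hstar m (spot_hashes m d s) k S"
    have S: "S \<subseteq> J" "i \<in> S" "finite S"
      using J fJ by (auto simp: S_def ideal_set_def)
    have Sm: "S - {i} \<subseteq> {1..m}" using S J by auto
    have hB: "\<bar>real (h j) - real (h i)\<bar> \<le> B" if j: "j \<in> S" for j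
    proof (cases "k < spot_steps m")
      case True
      have "h a \<in> {1..spot_range \<alpha> k}" if "a \<in> S" for a
      proof -
        have "a \<in> {1..m}" using that S J by auto
        then have "uniform_rv P (\<lambda>s. spot_hashes m d s k a) {1..spot_range \<alpha> k}"
          using law True by (auto simp: spot_law_def)
        from uniform_rv_in[OF this _ _ s] pos[of k]
        show ?thesis using True by (simp add: h_def step_hash_def)
      qed
      from this[OF j] this[OF S(2)]
      have "real (h j) \<le> real (spot_range \<alpha> k)" "real (h i) \<le> real (spot_range \<alpha> k)" by simp_all
      then show ?thesis
        using B(1)[OF True] of_nat_0_le_iff[of "h j"] of_nat_0_le_iff[of "h i"] by linarith
    next
      case False
      then have hs: "h = hstar S" and ks: "k = spot_steps m" using k by (auto simp: h_def step_hash_def)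
      have "hstar S ` S \<subseteq> {1..card S}"
        using inj S(3) by (auto simp: injection_rule_def)
      then have "h j \<in> {1..card S}" "h i \<in> {1..card S}"
        using hs S(2) j by blast+
      moreover have "card S \<le> card {1..m}"
        using S J by (intro card_mono) auto
      ultimately have "real (h j) \<le> real m" "real (h i) \<le> real m" by simp_all
      then show ?thesis
        using B(2)[OF ks] of_nat_0_le_iff[of "h j"] of_nat_0_le_iff[of "h i"] by linarith
    qed
    have B0: "0 \<le> B" using hB[OF S(2)] by simp
    let ?E1 = "{t. \<bar>spot_signs m d t k i\<bar> \<noteq> 1}"
    let ?E2 = "{t. \<bar>x i\<bar> / 10 \<le> \<bar>\<Sum>j\<in>S - {i}. x j * spot_signs m d t k j\<bar>}"
    let ?E3 = "{t. 9 / 20 * \<bar>x i\<bar>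
        \<le> \<bar>\<Sum>j\<in>S - {i}. ((real (h j) - real (h i)) * x j) * spot_signs m d t k j\<bar>}"
    have "measure_pmf.prob P {t. spot_bad hstar m x J i k (spot_hashes m d s) (spot_signs m d t)}
        = measure_pmf.prob P ((?E1 \<union> ?E2) \<union> ?E3)"
      by (intro arg_cong[where f="measure_pmf.prob P"]) (auto simp: spot_bad_def Let_def S_def h_def)
    also have "\<dots> \<le> measure_pmf.prob P ?E1 + measure_pmf.prob P ?E2 + measure_pmf.prob P ?E3"
      by (rule order_trans[OF measure_Un_le add_right_mono[OF measure_Un_le]]) auto
    also have "measure_pmf.prob P ?E1 = 0"
      using uniform_sign_cases[OF us, of i] J by (force simp: measure_pmf_zero_iff)
    also have "measure_pmf.prob P ?E2 \<le> (\<Sum>j\<in>S - {i}. (x j)\<^sup>2) / (\<bar>x i\<bar> / 10)\<^sup>2"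
      using S Sm us xi by (intro sign_sum_tail pairwise_indep_subset[OF ps]) auto
    also have "measure_pmf.prob P ?E3
        \<le> (\<Sum>j\<in>S - {i}. ((real (h j) - real (h i)) * x j)\<^sup>2) / (9 / 20 * \<bar>x i\<bar>)\<^sup>2"
      using S Sm us xi by (intro sign_sum_tail pairwise_indep_subset[OF ps]) auto
    also have "\<dots> \<le> (\<Sum>j\<in>S - {i}. B\<^sup>2 * (x j)\<^sup>2) / (9 / 20 * \<bar>x i\<bar>)\<^sup>2"
    proof (intro divide_right_mono sum_mono)
      fix j assume "j \<in> S - {i}"
      then have "(real (h j) - real (h i))\<^sup>2 \<le> B\<^sup>2"
        using hB[of j] B0 by (subst abs_le_square_iff[symmetric]) auto
      then show "((real (h j) - real (h i)) * x j)\<^sup>2 \<le> B\<^sup>2 * (x j)\<^sup>2"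
        by (simp add: power_mult_distrib mult_right_mono)
    qed auto
    also have "0 + (\<Sum>j\<in>S - {i}. (x j)\<^sup>2) / (\<bar>x i\<bar> / 10)\<^sup>2
        + (\<Sum>j\<in>S - {i}. B\<^sup>2 * (x j)\<^sup>2) / (9 / 20 * \<bar>x i\<bar>)\<^sup>2 = ?c * (\<Sum>j\<in>S - {i}. (x j)\<^sup>2)"
      using xi by (simp add: sum_distrib_left[symmetric] field_simps power2_eq_square)
    also have "\<dots> = (\<Sum>j\<in>S - {i}. ?c * (x j)\<^sup>2)"
      by (simp add: sum_distrib_left)
    also have "\<dots> = (\<Sum>j\<in>J - {i}. ?c * (x j)\<^sup>2 * of_bool (j \<in> S))"
      using S fJ by (intro sum.mono_neutral_cong_left) auto
    finally show ?thesis by (simp add: S_def)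
  qed
  have "measure_pmf.prob P {s. spot_bad hstar m x J i k (spot_hashes m d s) (spot_signs m d s)}
      \<le> measure_pmf.expectation P (\<lambda>s. ?g (spot_hashes m d s))"
    by (rule indep_pair_prob_le[where F="spot_bad hstar m x J i k" and g="?g", OF indS le])
      (auto intro!: Bochner_Integration.integrable_sum integrable_mult_right int simp del: of_bool_def)
  also have "\<dots> = (\<Sum>j\<in>J - {i}. ?c * (x j)\<^sup>2 *
      measure_pmf.expectation P (\<lambda>s. of_bool (j \<in> ideal_set (spot_hashes m d s) J i k)))"
    by (subst Bochner_Integration.integral_sum) (intro integrable_mult_right int, simp)
  also have "\<dots> = (\<Sum>j\<in>J - {i}. ?c * (x j)\<^sup>2 * (\<Prod>l<k. 1 / real (spot_range \<alpha> l)))"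
  proof (intro sum.cong refl arg_cong2[where f="(*)"])
    fix j assume j: "j \<in> J - {i}"
    have "measure_pmf.expectation P (\<lambda>s. of_bool (j \<in> ideal_set (spot_hashes m d s) J i k))
        = measure_pmf.expectation P
            (indicator {s. \<forall>l<k. spot_hashes m d s l j = spot_hashes m d s l i})"
      using j by (intro Bochner_Integration.integral_cong) (auto simp: ideal_set_def indicator_def)
    also have "\<dots> = measure_pmf.prob P {s. \<forall>l<k. spot_hashes m d s l j = spot_hashes m d s l i}"
      by simp
    also have "\<dots> = (\<Prod>l<k. 1 / real (spot_range \<alpha> l))"
      using j J by (intro spot_ideal_prob[OF law k _ _ _ pos]) auto
    finally show "measure_pmf.expectation P (\<lambda>s. of_bool (j \<in> ideal_set (spot_hashes m d s) J i k))
        = (\<Prod>l<k. 1 / real (spot_range \<alpha> l))" .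
  qed
  also have "\<dots> = ?c * (\<Prod>l<k. 1 / real (spot_range \<alpha> l)) * (\<Sum>j\<in>J - {i}. (x j)\<^sup>2)"
    unfolding sum_distrib_left by (intro sum.cong refl) (simp only: mult_ac)
  finally show ?thesis .
qed

section \<open>Growth of the hash ranges and the total failure probability of Spot\<close>

lemma spot_range_bounds:
  assumes "0 < \<alpha>" "\<alpha> \<le> 1 / 2"
  defines "b \<equiv> \<lambda>k::nat. 2 powr (8 * (9/8) ^ k + real k + 2) / \<alpha>"
  shows "b k \<le> real (spot_range \<alpha> k)" "real (spot_range \<alpha> k) \<le> b k + 1" "2048 \<le> b k"
proof -
  have "0 \<le> b k" using assms by (simp add: b_def)
  then show "b k \<le> real (spot_range \<alpha> k)" "real (spot_range \<alpha> k) \<le> b k + 1"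
    by (simp_all add: spot_range_def b_def)
  have "1 \<le> (9/8 :: real) ^ k" by simp
  \<comment> \<open>The exponent is smallest at \<open>k = 0\<close>; together with \<alpha> \<le>
    1/2 this gives 2048.\<close>
  then have "10 \<le> 8 * (9/8 :: real) ^ k + real k + 2"
    using of_nat_0_le_iff[of k, where 'a=real] by linarith
  then have "(2::real) powr 10 \<le> 2 powr (8 * (9/8) ^ k + real k + 2)"
    by (intro powr_mono) auto
  moreover have "(2::real) powr 10 = 1024" by (simp add: powr_numeral)
  ultimately have "1024 / (1/2) \<le> b k"
    unfolding b_def using assms(1,2) by (intro frac_le) auto
  then show "2048 \<le> b k" by simp
qed

text \<open>The base 9/8 works because twice 9 is less than three times 8: the exponents of 2 differ
  by 6 (9/8)^k + k, which is at least 4. The resulting factor 16 pays for the 4 in the claim and for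
  rounding, which at most doubles the range before squaring. The surplus power of 1/\<alpha> is at
  least 1.\<close>

lemma spot_range_growth:
  assumes "0 < \<alpha>" "\<alpha> \<le> 1 / 2"
  shows "4 * (real (spot_range \<alpha> (Suc k)))\<^sup>2 \<le> (real (spot_range \<alpha> k)) ^ 3"
proof -
  define q where "q = (9/8 :: real) ^ k"
  define b where "b k = 2 powr (8 * (9/8) ^ k + real k + 2) / \<alpha>" for k :: nat
  note B = spot_range_bounds[OF assms, folded b_def]
  have q: "1 \<le> q" by (simp add: q_def)
  have b0: "0 < b k" for k using B(3)[of k] by linarith
  have e: "b (Suc k) = 2 powr (9 * q + real k + 3) / \<alpha>" "b k = 2 powr (8 * q + real k + 2) / \<alpha>"
    by (simp_all add: b_def q_def algebra_simps)
  have b1: "(b (Suc k))\<^sup>2 = 2 powr (18 * q + 2 * real k + 6) / \<alpha>\<^sup>2"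
    unfolding e power_divide by (simp add: powr_power algebra_simps)
  have b3: "(b k) ^ 3 = 2 powr (24 * q + 3 * real k + 6) / \<alpha> ^ 3"
    unfolding e power_divide by (simp add: powr_power algebra_simps)
  have "16 * (2 powr (18 * q + 2 * real k + 6) * \<alpha>) \<le> 2 powr (24 * q + 3 * real k + 6)"
  proof -
    have "16 * (2 powr (18 * q + 2 * real k + 6) * \<alpha>) \<le> 16 * (2 powr (18 * q + 2 * real k + 6) * 1)"
      using assms by (intro mult_left_mono) auto
    also have "\<dots> = 2 powr 4 * 2 powr (18 * q + 2 * real k + 6)"
      by (simp add: powr_numeral)
    also have "\<dots> \<le> 2 powr (24 * q + 3 * real k + 6)"
      unfolding powr_add[symmetric] using q by (intro powr_mono) auto
    finally show ?thesis .
  qed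
  then have "16 * (2 powr (18 * q + 2 * real k + 6) * \<alpha>) / \<alpha> ^ 3 \<le> (b k) ^ 3"
    unfolding b3 using assms(1) by (intro divide_right_mono) auto
  moreover have "16 * (2 powr (18 * q + 2 * real k + 6) * \<alpha>) / \<alpha> ^ 3 = 16 * (b (Suc k))\<^sup>2"
    unfolding b1 using assms(1) by (simp add: power2_eq_square power3_eq_cube)
  ultimately have *: "16 * (b (Suc k))\<^sup>2 \<le> (b k) ^ 3" by simp
  have "real (spot_range \<alpha> (Suc k)) \<le> 2 * b (Suc k)"
    using B(2)[of "Suc k"] B(3)[of "Suc k"] by linarith
  then have "4 * (real (spot_range \<alpha> (Suc k)))\<^sup>2 \<le> 4 * (2 * b (Suc k))\<^sup>2"
    by (intro mult_left_mono power_mono) auto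
  also have "\<dots> \<le> (b k) ^ 3" using * by (simp add: power_mult_distrib)
  also have "\<dots> \<le> (real (spot_range \<alpha> k)) ^ 3"
    using B(1)[of k] b0[of k] by (intro power_mono) auto
  finally show ?thesis .
qed

text \<open>The number of steps is chosen such that 8 (9/8)^n \<ge> log_2 m for
  \<open>n = spot_steps m\<close>. So the final injective hash, with values up to m, obeys the bound
  of a hash with range \<open>spot_range \<alpha> n\<close>, and the last step fits into the same
  geometric decay.\<close>

lemma spot_range_final:
  assumes "0 < \<alpha>" "\<alpha> \<le> 1 / 2" "1 \<le> m"
  shows "real m \<le> real (spot_range \<alpha> (spot_steps m))"
proof -
  define n where "n = spot_steps m"
  define b where "b k = 2 powr (8 * (9/8) ^ k + real k + 2) / \<alpha>" for k :: nat
  note B = spot_range_bounds[OF assms(1,2), folded b_def]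
  show ?thesis
  proof (cases "m = 1")
    \<comment> \<open>Here the logarithm defining the number of steps degenerates, but the lower
      bound 2048 suffices.\<close>
    case True
    then show ?thesis using B(1)[of n] B(3)[of n] by (simp add: n_def)
  next
    case False
    then have m: "2 \<le> m" using assms by simp
    define y where "y = log 2 (real m) / 8"
    have y: "0 < y" using m by (simp add: y_def)
    have "log (9/8) y \<le> real n"
      using False by (simp add: n_def spot_steps_def y_def) linarith
    then have "y \<le> (9/8) powr real n"
      using y by (simp add: log_le_iff)
    then have "log 2 (real m) \<le> 8 * (9/8) ^ n"
      by (simp add: y_def powr_realpow)
    then have "real m \<le> 2 powr (8 * (9/8) ^ n)"
      using m by (simp add: log_le_iff)
    also have "\<dots> \<le> 2 powr (8 * (9/8) ^ n + real n + 2)"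
      by (intro powr_mono) auto
    also have "\<dots> \<le> b n"
      using assms by (simp add: b_def field_simps mult_le_cancel_left1)
    finally show ?thesis using B(1)[of n] by (simp add: n_def)
  qed
qed

lemma sum_quarter_decay:
  fixes a :: "nat \<Rightarrow> real"
  assumes "\<And>k. 4 * a (Suc k) \<le> a k" and "0 \<le> a n"
  shows "(\<Sum>k\<le>n. a k) \<le> 4 / 3 * a 0"
proof -
  \<comment> \<open>The strengthening by \<open>a n / 3\<close> reserves room for the largest
    possible rest of the geometric series.\<close>
  have "(\<Sum>k\<le>n. a k) + a n / 3 \<le> 4 / 3 * a 0"
  proof (induction n)
    case (Suc n)
    then show ?case using assms(1)[of n] by simp
  qed simp
  then show ?thesis using assms(2) by simp
qed

text \<open>A union bound over the steps. The bound for step \<open>k\<close> is proportional to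
  D_k^2 / (D_0 ... D_(k-1)), which drops by a factor 4 per step, so the sum is governed by D_0^2, of
  order \<alpha>^(-2). The hypothesis \<open>tail\<close> supplies \<alpha>^3, and 5/6 \<alpha>
  remains.\<close>

lemma spot_failure:
  fixes x :: vec
  assumes law: "spot_law m \<alpha> d P" and inj: "injection_rule hstar"
    and \<alpha>: "0 < \<alpha>" "\<alpha> \<le> 1 / 2"
    and J: "J \<subseteq> {1..m}" "i \<in> J" and xi: "x i \<noteq> 0"
    and tail: "2 * 2049\<^sup>2 * (\<Sum>j\<in>J - {i}. (x j)\<^sup>2) \<le> \<alpha> ^ 3 * (x i)\<^sup>2"
  shows "measure_pmf.prob P
           {s. \<exists>k\<le>spot_steps m. spot_bad hstar m x J i k (spot_hashes m d s) (spot_signs m d s)} \<le> \<alpha>"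
proof -
  let ?n = "spot_steps m"
  let ?D = "\<lambda>k. real (spot_range \<alpha> k)"
  let ?E = "\<lambda>k. {s. spot_bad hstar m x J i k (spot_hashes m d s) (spot_signs m d s)}"
  define V where "V = (\<Sum>j\<in>J - {i}. (x j)\<^sup>2)"
  define a where "a k = (?D k)\<^sup>2 * (\<Prod>l<k. 1 / ?D l)" for k
  note B = spot_range_bounds[OF \<alpha>]
  have D: "2048 \<le> ?D k" for k using B(1)[of k] B(3)[of k] by linarith
  then have Dpos: "0 < spot_range \<alpha> k" for k
    by (metis gr0I of_nat_0 not_numeral_le_zero)
  have V0: "0 \<le> V" by (simp add: V_def sum_nonneg)
  have a0: "0 \<le> a k" for k by (auto simp: a_def intro!: mult_nonneg_nonneg prod_nonneg)
  have decay: "4 * a (Suc k) \<le> a k" for k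
  proof -
    have "0 < ?D k" using Dpos by simp
    then have "4 * (?D (Suc k))\<^sup>2 / ?D k \<le> (?D k)\<^sup>2"
      using spot_range_growth[OF \<alpha>, of k]
      by (simp add: pos_divide_le_eq power2_eq_square power3_eq_cube mult_ac)
    then have "4 * (?D (Suc k))\<^sup>2 / ?D k * (\<Prod>l<k. 1 / ?D l) \<le> (?D k)\<^sup>2 * (\<Prod>l<k. 1 / ?D l)"
      by (intro mult_right_mono prod_nonneg) auto
    then show ?thesis by (simp add: a_def mult_ac)
  qed
  have step: "measure_pmf.prob P (?E k) \<le> 5 * V / (x i)\<^sup>2 * a k" if k: "k \<le> ?n" for k
  proof -
    have "1 \<le> m" using J by (metis Suc_le_eq atLeastAtMost_iff less_le_trans One_nat_def
          subsetD zero_less_one order_trans)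
    then have "measure_pmf.prob P (?E k)
        \<le> (100 + 400 / 81 * (?D k)\<^sup>2) / (x i)\<^sup>2 * (\<Prod>l<k. 1 / ?D l) * V"
      unfolding V_def
      using spot_range_final[OF \<alpha>] law inj k J xi Dpos
      by (intro spot_step_prob) auto
    also have "\<dots> \<le> (5 * (?D k)\<^sup>2) / (x i)\<^sup>2 * (\<Prod>l<k. 1 / ?D l) * V"
    proof -
      have "2048\<^sup>2 \<le> (?D k)\<^sup>2" using D[of k] by (intro power_mono) auto
      \<comment> \<open>The surplus of 5 over 400/81 absorbs the 100 for ranges this large.\<close>
      then have "100 + 400 / 81 * (?D k)\<^sup>2 \<le> 5 * (?D k)\<^sup>2" by simp
      then show ?thesis
        using V0 by (intro mult_right_mono divide_right_mono prod_nonneg) auto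
    qed
    also have "\<dots> = 5 * V / (x i)\<^sup>2 * a k" by (simp add: a_def mult_ac)
    finally show ?thesis .
  qed
  have "measure_pmf.prob P (\<Union>k\<in>{..?n}. ?E k) \<le> (\<Sum>k\<le>?n. measure_pmf.prob P (?E k))"
    by (rule measure_UNION_le) auto
  also have "\<dots> \<le> (\<Sum>k\<le>?n. 5 * V / (x i)\<^sup>2 * a k)"
    using step by (intro sum_mono) auto
  also have "\<dots> = 5 * V / (x i)\<^sup>2 * (\<Sum>k\<le>?n. a k)" by (simp add: sum_distrib_left)
  also have "\<dots> \<le> 5 * V / (x i)\<^sup>2 * (4 / 3 * a 0)"
    using V0 by (intro mult_left_mono sum_quarter_decay decay a0) auto
  also have "\<dots> \<le> 5 * V / (x i)\<^sup>2 * (4 / 3 * (2049 / (2 * \<alpha>))\<^sup>2)"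
  proof -
    have "(2::real) powr 10 = 1024" by (simp add: powr_numeral)
    then have "?D 0 \<le> 1024 / \<alpha> + 1" using B(2)[of 0] by simp
    \<comment> \<open>Rounding up costs 1, which is at most 1/(2 \<alpha>). This is the origin of
      the constant 2049 in \<open>A_gamma\<close>.\<close>
    also have "\<dots> \<le> 2049 / (2 * \<alpha>)" using \<alpha> by (simp add: field_simps)
    finally have "(?D 0)\<^sup>2 \<le> (2049 / (2 * \<alpha>))\<^sup>2" by (intro power_mono) auto
    then show ?thesis using V0 by (intro mult_left_mono) (auto simp: a_def)
  qed
  also have "\<dots> = 5 / 6 * (2 * 2049\<^sup>2 * V) / ((x i)\<^sup>2 * \<alpha>\<^sup>2)"
    using \<alpha> by (simp add: field_simps power2_eq_square)
  also have "\<dots> \<le> 5 / 6 * (\<alpha> ^ 3 * (x i)\<^sup>2) / ((x i)\<^sup>2 * \<alpha>\<^sup>2)"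
    using tail by (intro divide_right_mono mult_left_mono) (auto simp: V_def)
  also have "\<dots> = 5 / 6 * \<alpha>"
    using \<alpha> xi by (simp add: field_simps power2_eq_square power3_eq_cube)
  also have "\<dots> \<le> \<alpha>" using \<alpha> by simp
  finally show ?thesis
    by (rule order_trans[rotated]) (intro eq_refl arg_cong[where f="measure_pmf.prob P"], auto)
qed

section \<open>BucketSelect\<close>

text \<open>A uniformly random function has independent uniform values, which reduces the claim to
  \<open>prob_collision\<close>.\<close>

lemma prob_uniform_function_collision:
  fixes X :: "'s \<Rightarrow> nat \<Rightarrow> 'b"
  assumes X: "uniform_rv P X (A \<rightarrow>\<^sub>E B)" and A: "finite A" "a \<in> A" "b \<in> A" "a \<noteq> b"
    and B: "finite B" "B \<noteq> {}"
  shows "measure_pmf.prob P {s. X s a = X s b} = 1 / card B"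
proof -
  let ?Q = "Pi_pmf A undefined (\<lambda>_. pmf_of_set B)"
  have "PiE_dflt A undefined (\<lambda>_. B) = (A \<rightarrow>\<^sub>E B)"
    by (auto simp: PiE_dflt_def PiE_def extensional_def)
  then have Q: "map_pmf X P = ?Q"
    using X A B by (simp add: uniform_rv_def Pi_pmf_of_set)
  have "indep_family ?Q (\<lambda>c f. f c) A"
    unfolding indep_family_def using A by (intro indep_vars_Pi_pmf)
  then have ind: "prob_space.indep_var (measure_pmf ?Q) (count_space UNIV) (\<lambda>f. f a)
      (count_space UNIV) (\<lambda>f. f b)"
    using indep_family_pairwise A unfolding pairwise_indep_def by blast
  have u: "uniform_rv ?Q (\<lambda>f. f c) B" if "c \<in> A" for c
    using A that by (simp add: uniform_rv_def Pi_pmf_component)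
  have "measure_pmf.prob P {s. X s a = X s b} = measure_pmf.prob (map_pmf X P) {f. f a = f b}"
    by (simp add: vimage_def)
  then show ?thesis
    unfolding Q using prob_collision[OF ind u[OF A(2)] u[OF A(3)] B] by simp
qed

definition colliding :: "nat \<Rightarrow> nat \<Rightarrow> (nat \<Rightarrow> nat) \<Rightarrow> (nat \<Rightarrow> nat) \<Rightarrow> nat \<Rightarrow> nat set" where
  "colliding m D h H d = {j \<in> {1..m}. h j \<in> {1..D} \<and> h j \<noteq> d \<and> H (h j) = H d}"

lemma bs_meas_eq:
  assumes "d \<in> {1..D}"
  shows "bs_meas m D h H \<sigma> (H d) x = (\<Sum>j\<in>bucket m h d \<union> colliding m D h H d. x j * \<sigma> j)"
proof -
  have "bs_meas m D h H \<sigma> (H d) x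
      = (\<Sum>j\<in>(\<Union>d'\<in>{d' \<in> {1..D}. H d' = H d}. bucket m h d'). \<sigma> j * x j)"
    unfolding bs_meas_def by (subst sum.UNION_disjoint) (auto simp: bucket_def)
  also have "(\<Union>d'\<in>{d' \<in> {1..D}. H d' = H d}. bucket m h d') = bucket m h d \<union> colliding m D h H d"
    using assms by (auto simp: bucket_def colliding_def)
  finally show ?thesis by (simp add: mult.commute)
qed

text \<open>
  For a light bucket take \<open>A = J\<^sub>d\<close>, for a bucket with a large coordinate \<open>i\<close> take \<open>A = J\<^sub>d - {i}\<close>.
\<close>

definition bs_noise ::
  "nat \<Rightarrow> nat \<Rightarrow> (nat \<Rightarrow> nat) \<Rightarrow> vec \<Rightarrow> nat \<Rightarrow> nat set \<Rightarrow> nat \<Rightarrow> (nat \<Rightarrow> nat \<Rightarrow> nat) \<Rightarrow>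
   (nat \<times> nat \<Rightarrow> real) \<Rightarrow> real" where
  "bs_noise m D h x d A r u v = (\<Sum>j\<in>A \<union> colliding m D h (u r) d. x j * v (r, j))"

text \<open>For frozen group hashes, repetition \<open>r\<close> reads only row \<open>r\<close> of
  the signs, and the rows are disjoint blocks of an independent family.\<close>

lemma bs_noise_independent_tail:
  fixes x :: vec
  assumes signs: "indep_family P (\<lambda>ri s. bs_signs m R s ri) ({1..R} \<times> {1..m})"
    and S: "S \<subseteq> {1..R}" and A: "A \<subseteq> {1..m}"
  shows "measure_pmf.prob P {s. \<forall>r\<in>S. T \<le> \<bar>bs_noise m D h x d A r u (bs_signs m R s)\<bar>}
       = (\<Prod>r\<in>S. measure_pmf.prob P {s. T \<le> \<bar>bs_noise m D h x d A r u (bs_signs m R s)\<bar>})"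
proof (cases "S = {}")
  case False
  let ?K = "\<lambda>r. {r} \<times> {1..m}" and ?X = "\<lambda>ri s. bs_signs m R s ri"
  let ?W = "\<lambda>r s. bs_noise m D h x d A r u (bs_signs m R s)"
  let ?Y = "\<lambda>r v. (\<Sum>j\<in>A \<union> colliding m D h (u r) d. x j * v (r, j))"
  let ?E = "{y. T \<le> \<bar>y\<bar>} :: real set"
  have N: "A \<union> colliding m D h (u r) d \<subseteq> {1..m}" for r
    using A by (auto simp: colliding_def)
  have "prob_space.indep_vars (measure_pmf P) (\<lambda>r. PiM (?K r) (\<lambda>_. count_space UNIV))
      (\<lambda>r s. restrict (\<lambda>ri. ?X ri s) (?K r)) S"
    using S by (intro prob_space.indep_vars_restrict[OF prob_space_measure_pmf
          signs[unfolded indep_family_def]]) (auto simp: disjoint_family_on_def)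
  then have "prob_space.indep_vars (measure_pmf P) (\<lambda>_. borel)
      (\<lambda>r s. ?Y r (restrict (\<lambda>ri. ?X ri s) (?K r))) S"
  proof (rule prob_space.indep_vars_compose2[OF prob_space_measure_pmf])
    fix r assume "r \<in> S"
    show "?Y r \<in> borel_measurable (PiM (?K r) (\<lambda>_. count_space UNIV))"
    proof (intro borel_measurable_sum borel_measurable_times borel_measurable_const)
      fix j assume "j \<in> A \<union> colliding m D h (u r) d"
      then have "(r, j) \<in> ?K r" using N[of r] by auto
      then have "(\<lambda>v. v (r, j)) \<in> measurable (PiM (?K r) (\<lambda>_. count_space UNIV :: real measure)) (count_space UNIV)"
        by (rule measurable_component_singleton)
      then show "(\<lambda>v. v (r, j)) \<in> borel_measurable (PiM (?K r) (\<lambda>_. count_space UNIV :: real measure))"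
        by (rule measurable_compose) simp
    qed
  qed
  moreover have "?Y r (restrict (\<lambda>ri. ?X ri s) (?K r)) = ?W r s" for r s
    unfolding bs_noise_def using N[of r] by (intro sum.cong refl) auto
  ultimately have ind: "prob_space.indep_vars (measure_pmf P) (\<lambda>_. borel) ?W S" by simp
  have E: "?E \<in> sets borel" by measurable
  have fS: "finite S" using S finite_subset by blast
  have "measure_pmf.prob P {s. \<forall>r\<in>S. T \<le> \<bar>?W r s\<bar>}
      = measure_pmf.prob P (\<Inter>r\<in>S. ?W r -` ?E \<inter> space (measure_pmf P))"
    using False by (intro arg_cong[where f="measure_pmf.prob P"]) auto
  also have "\<dots> = (\<Prod>r\<in>S. measure_pmf.prob P (?W r -` ?E \<inter> space (measure_pmf P)))"
    by (rule prob_space.indep_varsD_finite[OF prob_space_measure_pmf ind False fS E])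
  finally show ?thesis by (simp add: vimage_def)
qed simp

lemma square_le_powr:
  fixes y p :: real
  assumes "0 \<le> y" "y \<le> 1" "p \<le> 2"
  shows "y\<^sup>2 \<le> y powr p"
proof (cases "y = 0")
  case False
  then have "y powr 2 \<le> y powr p" using assms by (intro powr_mono') auto
  then show ?thesis using False assms by (simp add: powr_numeral)
qed simp

text \<open>A single colliding coordinate of size at least \<open>T\<close> makes the right-hand
  side at least 1. Otherwise Chebyshev's inequality applies, and the squares of ratios below 1 are
  at most their p-th powers. Thus large and small colliding coordinates are charged to the same
  sum.\<close>

lemma bs_noise_tail:
  fixes x :: vec
  assumes signs: "indep_family P (\<lambda>ri s. bs_signs m R s ri) ({1..R} \<times> {1..m})"
    and us: "\<forall>ri\<in>{1..R} \<times> {1..m}. uniform_rv P (\<lambda>s. bs_signs m R s ri) {-1, 1}"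
    and r: "r \<in> {1..R}" and A: "A \<subseteq> bucket m h d" and T: "0 < T" and p: "1 \<le> p" "p \<le> 2"
  shows "measure_pmf.prob P {s. T \<le> \<bar>bs_noise m D h x d A r u (bs_signs m R s)\<bar>}
           \<le> (\<Sum>j\<in>A. (x j)\<^sup>2) / T\<^sup>2 + (\<Sum>j\<in>colliding m D h (u r) d. (\<bar>x j\<bar> / T) powr p)"
    (is "?lhs \<le> ?v + ?c")
proof (cases "\<exists>j\<in>colliding m D h (u r) d. T \<le> \<bar>x j\<bar>")
  case True
  then obtain j where j: "j \<in> colliding m D h (u r) d" "T \<le> \<bar>x j\<bar>" by blast
  have "1 \<le> (\<bar>x j\<bar> / T) powr p" using j T p by (intro ge_one_powr_ge_zero) auto
  also have "\<dots> \<le> ?c"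
    by (rule member_le_sum[OF j(1)]) (auto simp: colliding_def)
  finally have "1 \<le> ?v + ?c" by (simp add: add_increasing sum_nonneg)
  then show ?thesis using measure_pmf.prob_le_1 order_trans by blast
next
  case False
  let ?C = "colliding m D h (u r) d"
  have fin: "finite A" "finite ?C" and disj: "A \<inter> ?C = {}" and sub: "A \<union> ?C \<subseteq> {1..m}"
    using A finite_subset[OF A] by (auto simp: bucket_def colliding_def)
  have "pairwise_indep P (\<lambda>j s. bs_signs m R s (r, j)) {1..m}"
    using indep_family_pairwise[OF signs] r by (auto simp: pairwise_indep_def)
  then have "?lhs \<le> (\<Sum>j\<in>A \<union> ?C. (x j)\<^sup>2) / T\<^sup>2"
    unfolding bs_noise_def using sub fin us r T
    by (intro sign_sum_tail) (auto intro: pairwise_indep_subset)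
  also have "\<dots> = ?v + (\<Sum>j\<in>?C. (\<bar>x j\<bar> / T)\<^sup>2)"
    using fin disj by (simp add: sum.union_disjoint add_divide_distrib sum_divide_distrib power_divide)
  also have "\<dots> \<le> ?v + ?c"
    using False T p by (intro add_left_mono sum_mono square_le_powr) (auto simp: not_le less_imp_le)
  finally show ?thesis .
qed

text \<open>Independence enters twice: over the rows of signs for frozen hashes, then over the hash
  vectors of the repetitions. The bound for one repetition has mean at most \<open>q\<close>, as a
  coordinate of another bucket collides with probability 1/G.\<close>

lemma bs_all_noisy:
  fixes x :: vec
  assumes law: "bs_law m D R G P" and G: "1 \<le> G" and S: "S \<subseteq> {1..R}" and d: "d \<in> {1..D}"
    and A: "A \<subseteq> bucket m h d" and T: "0 < T" and p: "1 \<le> p" "p \<le> 2"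
    and q: "(\<Sum>j\<in>A. (x j)\<^sup>2) / T\<^sup>2 + (\<Sum>j\<in>{1..m}. (\<bar>x j\<bar> / T) powr p) / real G \<le> q"
  shows "measure_pmf.prob P
           {s. \<forall>r\<in>S. T \<le> \<bar>bs_noise m D h x d A r (bs_hashes D R s) (bs_signs m R s)\<bar>} \<le> q ^ card S"
proof -
  let ?v = "(\<Sum>j\<in>A. (x j)\<^sup>2) / T\<^sup>2"
  define M where "M = {j \<in> {1..m}. h j \<in> {1..D} \<and> h j \<noteq> d}"
  define w where "w j = (\<bar>x j\<bar> / T) powr p" for j
  \<comment> \<open>The bound of \<open>bs_noise_tail\<close> as a function of the hash vector of
    one repetition; with collisions written as indicators its expectation is computed
    termwise.\<close>
  define g where "g f = ?v + (\<Sum>j\<in>M. w j * of_bool (f (h j) = f d))" for f :: "nat \<Rightarrow> nat"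
  have w: "0 \<le> w j" for j by (simp add: w_def)
  have M: "finite M" "M \<subseteq> {1..m}" by (auto simp: M_def)
  have v: "0 \<le> ?v" by (simp add: sum_nonneg)
  have g0: "0 \<le> g f" for f by (auto simp: g_def w v intro!: add_nonneg_nonneg sum_nonneg)
  have gB: "\<bar>g f\<bar> \<le> ?v + (\<Sum>j\<in>M. w j)" for f
    using g0[of f] by (auto simp: g_def w intro!: sum_mono)
  have fS: "finite S" using S finite_subset by blast
  have g_eq: "g f = ?v + (\<Sum>j\<in>colliding m D h f d. (\<bar>x j\<bar> / T) powr p)" for f
    unfolding g_def w_def by (intro arg_cong2[where f="(+)"] refl sum.mono_neutral_cong_right)
      (auto simp: M_def colliding_def)
  have u: "uniform_rv P (\<lambda>s. bs_hashes D R s r) ({1..D} \<rightarrow>\<^sub>E {1..G})" if "r \<in> S" for r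
    using law S that by (auto simp: bs_law_def)
  have "indep_family P (\<lambda>r s. bs_hashes D R s r) {1..R}"
    using law by (simp add: bs_law_def)
  then have "prob_space.indep_vars (measure_pmf P) (\<lambda>_. count_space UNIV) (\<lambda>r s. bs_hashes D R s r) S"
    unfolding indep_family_def by (rule prob_space.indep_vars_subset[OF prob_space_measure_pmf _ S])
  then have ind: "prob_space.indep_vars (measure_pmf P) (\<lambda>_. borel) (\<lambda>r s. g (bs_hashes D R s r)) S"
    by (rule prob_space.indep_vars_compose2[OF prob_space_measure_pmf]) simp
  have int: "integrable (measure_pmf P) (\<lambda>s. g (bs_hashes D R s r))" for r
    by (rule integrable_pmf_bounded[OF gB])
  have ob: "integrable (measure_pmf P) (\<lambda>s. of_bool (Q s) :: real)" for Q
    by (rule integrable_pmf_bounded[where B=1]) auto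
  have Eg: "measure_pmf.expectation P (\<lambda>s. g (bs_hashes D R s r)) \<le> q" if r: "r \<in> S" for r
  proof -
    have "measure_pmf.expectation P (\<lambda>s. g (bs_hashes D R s r))
        = ?v + measure_pmf.expectation P
            (\<lambda>s. \<Sum>j\<in>M. w j * of_bool (bs_hashes D R s r (h j) = bs_hashes D R s r d))"
    proof -
      have "integrable (measure_pmf P)
          (\<lambda>s. \<Sum>j\<in>M. w j * of_bool (bs_hashes D R s r (h j) = bs_hashes D R s r d))"
        by (intro Bochner_Integration.integrable_sum integrable_mult_right ob)
      then show ?thesis unfolding g_def by (subst Bochner_Integration.integral_add) simp_all
    qed
    also have "\<dots> = ?v + (\<Sum>j\<in>M. w j * measure_pmf.expectation P
        (\<lambda>s. of_bool (bs_hashes D R s r (h j) = bs_hashes D R s r d)))"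
      by (subst Bochner_Integration.integral_sum) (intro integrable_mult_right ob, simp)
    also have "\<dots> = ?v + (\<Sum>j\<in>M. w j * (1 / real G))"
    proof (intro arg_cong2[where f="(+)"] arg_cong2[where f="(*)"] sum.cong refl)
      fix j assume "j \<in> M"
      then have j: "h j \<in> {1..D}" "h j \<noteq> d" by (auto simp: M_def)
      have "measure_pmf.expectation P (\<lambda>s. of_bool (bs_hashes D R s r (h j) = bs_hashes D R s r d))
          = measure_pmf.expectation P (indicator {s. bs_hashes D R s r (h j) = bs_hashes D R s r d})"
        by (intro Bochner_Integration.integral_cong) (auto simp: indicator_def)
      also have "\<dots> = 1 / real G"
        using prob_uniform_function_collision[OF u[OF r] _ j(1) d j(2)] G by simp
      finally show "measure_pmf.expectation P
          (\<lambda>s. of_bool (bs_hashes D R s r (h j) = bs_hashes D R s r d)) = 1 / real G" .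
    qed
    also have "\<dots> = ?v + (\<Sum>j\<in>M. w j) / real G" by (simp add: sum_divide_distrib)
    also have "\<dots> \<le> ?v + (\<Sum>j\<in>{1..m}. w j) / real G"
      using M w by (intro add_left_mono divide_right_mono sum_mono2) auto
    also have "\<dots> \<le> q" using q by (simp add: w_def)
    finally show ?thesis .
  qed
  have "measure_pmf.prob P
      {s. \<forall>r\<in>S. T \<le> \<bar>bs_noise m D h x d A r (bs_hashes D R s) (bs_signs m R s)\<bar>}
      \<le> measure_pmf.expectation P (\<lambda>s. \<Prod>r\<in>S. g (bs_hashes D R s r))"
  proof (rule indep_pair_prob_le[where Y="bs_signs m R" and X="bs_hashes D R"
        and g="\<lambda>u. \<Prod>r\<in>S. g (u r)"
        and F="\<lambda>u v. \<forall>r\<in>S. T \<le> \<bar>bs_noise m D h x d A r u v\<bar>"])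
    show "indep_pair P (bs_hashes D R) (bs_signs m R)" using law by (simp add: bs_law_def)
    show "integrable (measure_pmf P) (\<lambda>s. \<Prod>r\<in>S. g (bs_hashes D R s r))"
      using fS ind int by (intro prob_space.indep_vars_integrable[OF prob_space_measure_pmf]) auto
    fix s
    let ?u = "bs_hashes D R s"
    have "measure_pmf.prob P {t. \<forall>r\<in>S. T \<le> \<bar>bs_noise m D h x d A r ?u (bs_signs m R t)\<bar>}
        = (\<Prod>r\<in>S. measure_pmf.prob P {t. T \<le> \<bar>bs_noise m D h x d A r ?u (bs_signs m R t)\<bar>})"
      using law S A by (intro bs_noise_independent_tail) (auto simp: bs_law_def bucket_def)
    also have "\<dots> \<le> (\<Prod>r\<in>S. g (?u r))"
    proof (rule prod_mono, intro conjI)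
      fix r assume "r \<in> S"
      then show "measure_pmf.prob P {t. T \<le> \<bar>bs_noise m D h x d A r ?u (bs_signs m R t)\<bar>} \<le> g (?u r)"
        unfolding g_eq using law S A T p by (intro bs_noise_tail) (auto simp: bs_law_def)
    qed simp
    finally show "measure_pmf.prob P {t. \<forall>r\<in>S. T \<le> \<bar>bs_noise m D h x d A r ?u (bs_signs m R t)\<bar>}
        \<le> (\<Prod>r\<in>S. g (?u r))" .
  qed
  also have "\<dots> = (\<Prod>r\<in>S. measure_pmf.expectation P (\<lambda>s. g (bs_hashes D R s r)))"
    using fS ind int by (intro prob_space.indep_vars_lebesgue_integral[OF prob_space_measure_pmf]) auto
  also have "\<dots> \<le> (\<Prod>r\<in>S. q)"
    using Eg g0 by (intro prod_mono) (auto intro!: Bochner_Integration.integral_nonneg)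
  finally show ?thesis by simp
qed

section \<open>Medians and majorities of repetitions\<close>

lemma length_filter_sort: "length (filter Q (sort xs)) = length (filter Q xs)"
  by (metis mset_filter mset_sort size_mset)

text \<open>If the median reached \<open>T\<close>, so would all t + 1 entries of the sorted list
  from position \<open>t\<close> on.\<close>

lemma med_less:
  assumes len: "length xs = 2 * t + 1" and few: "length (filter (\<lambda>y. T \<le> y) xs) \<le> t"
  shows "med xs < T"
proof (rule ccontr)
  let ?ys = "sort xs"
  assume "\<not> med xs < T"
  then have T: "T \<le> ?ys ! t" by (simp add: med_def len)
  have "{t..2 * t} \<subseteq> {n. n < length ?ys \<and> T \<le> ?ys ! n}"
  proof
    fix n assume n: "n \<in> {t..2 * t}"
    then have "?ys ! t \<le> ?ys ! n"
      using len by (intro sorted_nth_mono) auto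
    then show "n \<in> {n. n < length ?ys \<and> T \<le> ?ys ! n}" using T n len by auto
  qed
  then have "card {t..2 * t} \<le> length (filter (\<lambda>y. T \<le> y) ?ys)"
    unfolding length_filter_conv_card by (intro card_mono) auto
  then show False using few by (simp add: length_filter_sort)
qed

lemma med_greater:
  assumes len: "length xs = 2 * t + 1" and few: "length (filter (\<lambda>y. y \<le> T) xs) \<le> t"
  shows "T < med xs"
proof (rule ccontr)
  let ?ys = "sort xs"
  assume "\<not> T < med xs"
  then have T: "?ys ! t \<le> T" by (simp add: med_def len)
  have "{0..t} \<subseteq> {n. n < length ?ys \<and> ?ys ! n \<le> T}"
  proof
    fix n assume n: "n \<in> {0..t}"
    then have "?ys ! n \<le> ?ys ! t"
      using len by (intro sorted_nth_mono) auto
    then show "n \<in> {n. n < length ?ys \<and> ?ys ! n \<le> T}" using T n len by auto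
  qed
  then have "card {0..t} \<le> length (filter (\<lambda>y. y \<le> T) ?ys)"
    unfolding length_filter_conv_card by (intro card_mono) auto
  then show False using few by (simp add: length_filter_sort)
qed

lemma length_filter_map_upt:
  "length (filter Q (map f [1..<Suc R])) = card {r \<in> {1..R}. Q (f r)}"
proof -
  have "length (filter Q (map f [1..<Suc R])) = length (filter (\<lambda>r. Q (f r)) [1..<Suc R])"
    by (simp add: filter_map comp_def del: upt_Suc)
  also have "\<dots> = card (set (filter (\<lambda>r. Q (f r)) [1..<Suc R]))"
    by (intro distinct_card[symmetric] distinct_filter distinct_upt)
  also have "set (filter (\<lambda>r. Q (f r)) [1..<Suc R]) = {r \<in> {1..R}. Q (f r)}"
    by auto
  finally show ?thesis .
qed

text \<open>A union bound over the \<open>n\<close>-element sets of repetitions. The crude count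
  \<open>2 ^ R\<close> of these sets is later outweighed by powers of 1/8.\<close>

lemma prob_many_bad:
  fixes bad :: "nat \<Rightarrow> 's \<Rightarrow> bool"
  assumes "\<And>S. S \<subseteq> {1..R} \<Longrightarrow> card S = n \<Longrightarrow> measure_pmf.prob P {s. \<forall>r\<in>S. bad r s} \<le> c"
    and c: "0 \<le> c"
  shows "measure_pmf.prob P {s. n \<le> card {r \<in> {1..R}. bad r s}} \<le> 2 ^ R * c"
proof -
  let ?F = "{S. S \<subseteq> {1..R} \<and> card S = n}"
  have fin: "finite ?F" by (rule finite_subset[of _ "Pow {1..R}"]) auto
  have "card ?F \<le> card (Pow {1..R})" by (intro card_mono) auto
  then have card: "card ?F \<le> 2 ^ R" by (simp add: card_Pow)
  have "{s. n \<le> card {r \<in> {1..R}. bad r s}} \<subseteq> (\<Union>S\<in>?F. {s. \<forall>r\<in>S. bad r s})"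
  proof
    fix s assume "s \<in> {s. n \<le> card {r \<in> {1..R}. bad r s}}"
    then obtain S where "S \<subseteq> {r \<in> {1..R}. bad r s}" "card S = n"
      by (auto elim: obtain_subset_with_card_n)
    then have "S \<in> ?F" "\<forall>r\<in>S. bad r s" by auto
    then show "s \<in> (\<Union>S\<in>?F. {s. \<forall>r\<in>S. bad r s})" by blast
  qed
  then have "measure_pmf.prob P {s. n \<le> card {r \<in> {1..R}. bad r s}}
      \<le> measure_pmf.prob P (\<Union>S\<in>?F. {s. \<forall>r\<in>S. bad r s})"
    by (intro measure_pmf.finite_measure_mono) auto
  also have "\<dots> \<le> (\<Sum>S\<in>?F. measure_pmf.prob P {s. \<forall>r\<in>S. bad r s})"
    using fin by (intro measure_UNION_le) auto
  also have "\<dots> \<le> (\<Sum>S\<in>?F. c)" using assms by (intro sum_mono) auto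
  also have "\<dots> = real (card ?F) * c" by simp
  also have "\<dots> \<le> 2 ^ R * c"
  proof (rule mult_right_mono[OF _ c])
    show "real (card ?F) \<le> 2 ^ R"
      using card by (metis of_nat_le_iff of_nat_numeral of_nat_power)
  qed
  finally show ?thesis .
qed

definition bs_bad ::
  "nat \<Rightarrow> nat \<Rightarrow> nat \<Rightarrow> (nat \<Rightarrow> nat) \<Rightarrow> vec \<Rightarrow> real \<Rightarrow> nat \<Rightarrow> nat set \<Rightarrow> (nat \<Rightarrow> nat \<Rightarrow> nat) \<Rightarrow>
   (nat \<times> nat \<Rightarrow> real) \<Rightarrow> bool" where
  "bs_bad m D R h x T d A u v \<longleftrightarrow>
     R div 2 < card {r \<in> {1..R}. T \<le> \<bar>bs_noise m D h x d A r u v\<bar>}"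

text \<open>\<open>bs_law\<close> speaks of parameters restricted to their index sets, the algorithm
  of the fields of the seed. A bad event reads only indices where both agree.\<close>

lemma bs_bad_restrict:
  assumes "A \<subseteq> {1..m}" "d \<in> {1..D}"
  shows "bs_bad m D R h x T d A (bs_hashes D R s) (bs_signs m R s)
     \<longleftrightarrow> bs_bad m D R h x T d A (group_hash s) (\<lambda>(r, j). bs_sign s r j)"
proof -
  have "bs_noise m D h x d A r (bs_hashes D R s) (bs_signs m R s)
      = bs_noise m D h x d A r (group_hash s) (\<lambda>(r, j). bs_sign s r j)" if r: "r \<in> {1..R}" for r
  proof -
    have "colliding m D h (bs_hashes D R s r) d = colliding m D h (group_hash s r) d"
      using r assms(2) by (auto simp: colliding_def bs_hashes_def)
    then show ?thesis
      unfolding bs_noise_def using assms r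
      by (intro sum.cong) (auto simp: bs_signs_def colliding_def)
  qed
  then have "{r \<in> {1..R}. T \<le> \<bar>bs_noise m D h x d A r (bs_hashes D R s) (bs_signs m R s)\<bar>}
     = {r \<in> {1..R}. T \<le> \<bar>bs_noise m D h x d A r (group_hash s) (\<lambda>(r, j). bs_sign s r j)\<bar>}"
    by auto
  then show ?thesis by (simp add: bs_bad_def)
qed

lemma bs_Z_small:
  assumes "d \<in> {1..D}" "odd R"
    and "\<not> bs_bad m D R h x T d (bucket m h d) H (\<lambda>(r, j). \<sigma> r j)"
  shows "bs_Z m D R h H \<sigma> x d < T"
proof -
  obtain t where t: "R = 2 * t + 1" using assms(2) by (elim oddE)
  show ?thesis
    unfolding bs_Z_def
    by (rule med_less[of _ t], simp add: t, subst length_filter_map_upt)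
      (use assms t in \<open>simp add: bs_bad_def bs_noise_def bs_meas_eq\<close>)
qed

text \<open>The sign does not change the size of the contribution of \<open>i\<close>, which exceeds
  \<open>2 * T\<close>. So a measurement of size at most \<open>T\<close> needs noise of size at
  least \<open>T\<close>, which occurs only in a minority of the repetitions.\<close>

lemma bs_Z_large:
  assumes d: "d \<in> {1..D}" "odd R" and i: "i \<in> bucket m h d" "2 * T < \<bar>x i\<bar>"
    and \<sigma>: "\<And>r. r \<in> {1..R} \<Longrightarrow> \<bar>\<sigma> r i\<bar> = 1"
    and good: "\<not> bs_bad m D R h x T d (bucket m h d - {i}) H (\<lambda>(r, j). \<sigma> r j)"
  shows "T < bs_Z m D R h H \<sigma> x d"
proof -
  obtain t where t: "R = 2 * t + 1" using d(2) by (elim oddE)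
  let ?N = "\<lambda>r. bs_noise m D h x d (bucket m h d - {i}) r H (\<lambda>(r, j). \<sigma> r j)"
  have fin: "finite (bucket m h d \<union> colliding m D h (H r) d)" for r
    by (simp add: bucket_def colliding_def)
  have ni: "i \<notin> colliding m D h (H r) d" for r
    using i by (auto simp: bucket_def colliding_def)
  have eq: "bs_meas m D h (H r) (\<sigma> r) (H r d) x = x i * \<sigma> r i + ?N r" for r
  proof -
    have "bucket m h d \<union> colliding m D h (H r) d - {i}
        = (bucket m h d - {i}) \<union> colliding m D h (H r) d" using ni by auto
    then show ?thesis
      using i(1) fin[of r] by (simp add: bs_meas_eq[OF d(1)] bs_noise_def sum.remove[of _ i])
  qed
  have "{r \<in> {1..R}. \<bar>bs_meas m D h (H r) (\<sigma> r) (H r d) x\<bar> \<le> T} \<subseteq> {r \<in> {1..R}. T \<le> \<bar>?N r\<bar>}"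
  proof safe
    fix r assume r: "r \<in> {1..R}" "\<bar>bs_meas m D h (H r) (\<sigma> r) (H r d) x\<bar> \<le> T"
    have "\<bar>x i * \<sigma> r i\<bar> = \<bar>x i\<bar>" using \<sigma>[OF r(1)] by (simp add: abs_mult)
    then show "T \<le> \<bar>?N r\<bar>" using r(2) i(2) unfolding eq by linarith
  qed
  then have "card {r \<in> {1..R}. \<bar>bs_meas m D h (H r) (\<sigma> r) (H r d) x\<bar> \<le> T}
      \<le> card {r \<in> {1..R}. T \<le> \<bar>?N r\<bar>}"
    by (intro card_mono) auto
  also have "\<dots> \<le> t" using good t by (simp add: bs_bad_def)
  finally show ?thesis
    unfolding bs_Z_def
    by (intro med_greater[of _ t], simp add: t, subst length_filter_map_upt)
qed

text \<open>If \<open>d\<close> were missed, all \<open>k\<close> selected buckets would have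
  medians above \<open>T\<close> and hence lie outside \<open>L\<close>. Together with
  \<open>d\<close> these would be \<open>k + 1\<close> buckets outside \<open>L\<close>.\<close>

lemma bucket_select_contains:
  assumes sel: "selection_rule D k sel" and R: "odd R" and d: "d \<in> {1..D}"
    and i: "i \<in> bucket m h d" "2 * T < \<bar>x i\<bar>"
    and \<sigma>: "\<And>r. r \<in> {1..R} \<Longrightarrow> \<bar>\<sigma> r i\<bar> = 1"
    and good: "\<not> bs_bad m D R h x T d (bucket m h d - {i}) H (\<lambda>(r, j). \<sigma> r j)"
    and L: "d \<notin> L" "card ({1..D} - L) \<le> k"
    and light: "\<And>d'. d' \<in> L \<inter> {1..D} \<Longrightarrow>
       \<not> bs_bad m D R h x T d' (bucket m h d') H (\<lambda>(r, j). \<sigma> r j)"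
  shows "d \<in> bucket_select sel m D R h H \<sigma> x"
proof (rule ccontr)
  let ?Z = "\<lambda>d\<in>{1..D}. bs_Z m D R h H \<sigma> x d"
  assume "d \<notin> bucket_select sel m D R h H \<sigma> x"
  then have nd: "d \<notin> sel ?Z" by (simp add: bucket_select_def)
  have sub: "sel ?Z \<subseteq> {1..D}" and card: "card (sel ?Z) = k"
    using sel unfolding selection_rule_def by blast+
  have ge: "?Z d \<le> ?Z d'" if "d' \<in> sel ?Z" for d'
    using sel d nd that unfolding selection_rule_def by blast
  have "d' \<notin> L" if d': "d' \<in> sel ?Z" for d'
  proof
    assume "d' \<in> L"
    moreover have D': "d' \<in> {1..D}" using d' sub by blast
    ultimately have "bs_Z m D R h H \<sigma> x d' < T" using light R by (intro bs_Z_small) auto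
    moreover have "T < bs_Z m D R h H \<sigma> x d" by (rule bs_Z_large[OF d R i \<sigma> good])
    ultimately show False using ge[OF d'] d D' by simp
  qed
  then have "insert d (sel ?Z) \<subseteq> {1..D} - L" using sub d L by auto
  then have "card (insert d (sel ?Z)) \<le> card ({1..D} - L)" by (intro card_mono) auto
  moreover have "finite (sel ?Z)" using sub finite_subset by blast
  ultimately show False using nd card L by simp
qed

text \<open>For R = 2t + 1 a bad bucket has t + 1 noisy repetitions, so its probability is at most
  2^(2t+1) 8^(-t-1) = 2^(-t-2); a union bound over at most \<open>D\<close> buckets follows. The
  freedom in \<open>A\<close> treats light and heavy buckets at once.\<close>

lemma bs_failure:
  fixes x :: vec
  assumes law: "bs_law m D R G P" and G: "1 \<le> G" and R: "odd R"
    and T: "0 < T" and p: "1 \<le> p" "p \<le> 2" and DL: "L \<subseteq> {1..D}"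
    and A: "\<And>d. d \<in> L \<Longrightarrow> A d \<subseteq> bucket m h d"
    and q: "\<And>d. d \<in> L \<Longrightarrow>
       (\<Sum>j\<in>A d. (x j)\<^sup>2) / T\<^sup>2 + (\<Sum>j\<in>{1..m}. (\<bar>x j\<bar> / T) powr p) / real G \<le> 1 / 8"
  shows "measure_pmf.prob P {s. \<exists>d\<in>L. bs_bad m D R h x T d (A d) (bs_hashes D R s) (bs_signs m R s)}
           \<le> real D / (4 * 2 ^ (R div 2))"
proof -
  obtain t where t: "R = 2 * t + 1" using R by (elim oddE)
  have fL: "finite L" using DL finite_subset by blast
  have one: "measure_pmf.prob P {s. bs_bad m D R h x T d (A d) (bs_hashes D R s) (bs_signs m R s)}
      \<le> 1 / (4 * 2 ^ t)" if d: "d \<in> L" for d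
  proof -
    have "measure_pmf.prob P {s. Suc t \<le> card {r \<in> {1..R}. T \<le> \<bar>bs_noise m D h x d (A d) r
        (bs_hashes D R s) (bs_signs m R s)\<bar>}} \<le> 2 ^ R * (1 / 8) ^ Suc t"
    proof (rule prob_many_bad)
      fix S assume "S \<subseteq> {1..R}" "card S = Suc t"
      with bs_all_noisy[OF law G this(1) _ A[OF d] T p q[OF d]] d DL
      show "measure_pmf.prob P {s. \<forall>r\<in>S. T \<le> \<bar>bs_noise m D h x d (A d) r
          (bs_hashes D R s) (bs_signs m R s)\<bar>} \<le> (1 / 8) ^ Suc t" by auto
    qed simp
    also have "2 ^ R * (1 / 8) ^ Suc t = 1 / (4 * 2 ^ t :: real)"
    proof -
      have "(8::real) ^ t = (2 * 2 * 2) ^ t" by simp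
      then have "(8::real) ^ t = 2 ^ t * 2 ^ t * 2 ^ t"
        by (simp only: power_mult_distrib)
      moreover have "R = Suc (t + t)" by (simp add: t)
      then have "(2::real) ^ R = 2 * (2 ^ t * 2 ^ t)" by (simp only: power_Suc power_add)
      ultimately show ?thesis by (simp add: power_divide field_simps)
    qed
    finally show ?thesis by (simp add: bs_bad_def t less_eq_Suc_le)
  qed
  have "measure_pmf.prob P (\<Union>d\<in>L. {s. bs_bad m D R h x T d (A d) (bs_hashes D R s) (bs_signs m R s)})
      \<le> (\<Sum>d\<in>L. measure_pmf.prob P {s. bs_bad m D R h x T d (A d) (bs_hashes D R s) (bs_signs m R s)})"
    using fL by (intro measure_UNION_le) auto
  also have "\<dots> \<le> (\<Sum>d\<in>L. 1 / (4 * 2 ^ t))" using one by (intro sum_mono)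
  also have "\<dots> = real (card L) / (4 * 2 ^ t)" by simp
  also have "\<dots> \<le> real D / (4 * 2 ^ t)"
    using card_mono[OF _ DL] by (intro divide_right_mono) auto
  finally show ?thesis
    by (simp add: t UNION_eq)
qed

section \<open>Parameters of the algorithm\<close>

text \<open>Counterpart of \<open>bs_bad_restrict\<close>: the event reads hash values of steps
  before \<open>k\<close> and, unless step \<open>k\<close> is the final one, of step
  \<open>k\<close>, always at coordinates in \<open>{1..m}\<close>.\<close>

lemma spot_bad_restrict:
  assumes J: "J \<subseteq> {1..m}" "i \<in> J" and k: "k \<le> spot_steps m"
  shows "spot_bad hstar m x J i k (spot_hashes m d s) (spot_signs m d s)
     \<longleftrightarrow> spot_bad hstar m x J i k (spot_hash s d) (spot_sign s d)"
proof -
  have i: "i \<in> {1..m}" using J by blast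
  have H: "spot_hashes m d s l j = spot_hash s d l j" if "l < spot_steps m" "j \<in> {1..m}" for l j
    using that by (simp add: spot_hashes_def)
  have \<sigma>: "spot_signs m d s k j = spot_sign s d k j" if "j \<in> {1..m}" for j
    using that k by (simp add: spot_signs_def)
  define S where "S = ideal_set (spot_hash s d) J i k"
  have "ideal_set (spot_hashes m d s) J i k = S"
    unfolding ideal_set_def S_def using J i k by (intro Collect_cong conj_cong refl) (auto simp: H subset_iff)
  moreover have SJ: "S \<subseteq> {1..m}" using J by (auto simp: S_def ideal_set_def)
  moreover have "step_hash hstar m (spot_hashes m d s) k S j = step_hash hstar m (spot_hash s d) k S j"
    if "j \<in> {1..m}" for j
    using that by (auto simp: step_hash_def H)
  moreover have "(\<Sum>j\<in>S - {i}. x j * spot_signs m d s k j) = (\<Sum>j\<in>S - {i}. x j * spot_sign s d k j)"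
    using SJ \<sigma> by (intro sum.cong refl) (auto simp: subset_iff)
  moreover have "(\<Sum>j\<in>S - {i}. (real (f j) - real (f i)) * x j * spot_signs m d s k j)
      = (\<Sum>j\<in>S - {i}. (real (g j) - real (g i)) * x j * spot_sign s d k j)"
    if "\<And>j. j \<in> {1..m} \<Longrightarrow> f j = g j" for f g :: "nat \<Rightarrow> nat"
    using SJ \<sigma> that i by (intro sum.cong refl) (auto simp: subset_iff)
  ultimately show ?thesis
    unfolding spot_bad_def S_def[symmetric] Let_def using \<sigma>[OF i] by simp
qed

lemma bucket_main_params: "bucket m (main_params m s) = bucket m (main_hash s)"
  by (auto simp: bucket_def main_params_def fun_eq_iff)

lemma bs_bad_main_params: "bs_bad m D R (main_params m s) = bs_bad m D R (main_hash s)"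
proof -
  have "colliding m D (main_params m s) = colliding m D (main_hash s)"
    by (auto simp: colliding_def main_params_def fun_eq_iff)
  then show ?thesis by (simp add: bs_bad_def bs_noise_def fun_eq_iff)
qed

section \<open>Consequences of bounds on sums of p-th powers\<close>

lemma sum_powr_le_imp_abs_le:
  fixes x :: vec
  assumes "finite B" "(\<Sum>j\<in>B. \<bar>x j\<bar> powr p) \<le> c powr p" "0 < c" "0 < p" "j \<in> B"
  shows "\<bar>x j\<bar> \<le> c"
proof (rule ccontr)
  assume "\<not> \<bar>x j\<bar> \<le> c"
  then have "c powr p < \<bar>x j\<bar> powr p" using assms by (intro powr_less_mono2) auto
  also have "\<dots> \<le> (\<Sum>j\<in>B. \<bar>x j\<bar> powr p)"
    using assms by (intro member_le_sum) auto
  finally show False using assms by simp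
qed

text \<open>After division by \<open>c\<close> all entries are at most 1 in absolute value, and then
  squares are at most p-th powers.\<close>

lemma sum_squares_le:
  fixes x :: vec
  assumes B: "finite B" and le: "(\<Sum>j\<in>B. \<bar>x j\<bar> powr p) \<le> c powr p" and c: "0 < c"
    and p: "0 < p" "p \<le> 2"
  shows "(\<Sum>j\<in>B. (x j)\<^sup>2) \<le> c\<^sup>2"
proof -
  have "(\<Sum>j\<in>B. (\<bar>x j\<bar> / c)\<^sup>2) \<le> (\<Sum>j\<in>B. (\<bar>x j\<bar> / c) powr p)"
    using sum_powr_le_imp_abs_le[OF B le c p(1)] c p
    by (intro sum_mono square_le_powr) auto
  also have "\<dots> = (\<Sum>j\<in>B. \<bar>x j\<bar> powr p) / c powr p"
    using c by (simp add: powr_divide sum_divide_distrib)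
  also have "\<dots> \<le> 1" using le c by (simp add: divide_le_eq)
  finally have "(\<Sum>j\<in>B. (x j)\<^sup>2) / c\<^sup>2 \<le> 1"
    by (simp add: power_divide sum_divide_distrib)
  then show ?thesis using c by (simp add: divide_le_eq)
qed

lemma lp_norm_le_1:
  assumes "lp_norm p m x \<le> 1" "1 \<le> p"
  shows "(\<Sum>i\<in>{1..m}. \<bar>x i\<bar> powr p) \<le> 1"
proof (rule ccontr)
  let ?S = "\<Sum>i\<in>{1..m}. \<bar>x i\<bar> powr p"
  assume "\<not> ?S \<le> 1"
  then have "1 < ?S powr (1 / p)" using assms(2) by simp
  then show False using assms(1) by (simp add: lp_norm_def)
qed

text \<open>Serves two counts: coordinates larger than \<epsilon>, bounded by \<open>A_k0\<close>,
  and buckets that are not light, bounded by \<open>A_k\<close>.\<close>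

lemma card_large_groups:
  fixes f :: "'i \<Rightarrow> real"
  assumes "finite A" "(\<Sum>i\<in>A. f i) \<le> 1" "\<And>i. i \<in> A \<Longrightarrow> c < f i" "0 < c"
  shows "card A \<le> nat \<lfloor>1 / c\<rfloor>"
proof -
  have "real (card A) * c = (\<Sum>i\<in>A. c)" by simp
  also have "\<dots> \<le> (\<Sum>i\<in>A. f i)" using assms by (intro sum_mono) (auto intro: less_imp_le)
  also have "\<dots> \<le> 1" by fact
  finally have "real (card A) \<le> 1 / c" using assms by (simp add: field_simps)
  then show ?thesis by (simp add: le_nat_floor)
qed

section \<open>Numerical properties of the parameters\<close>

lemma A_k0_bounds:
  assumes "0 < \<epsilon>" "\<epsilon> < 1" "1 \<le> p"
  shows "1 \<le> A_k0 p \<epsilon>" "real (A_k0 p \<epsilon>) \<le> \<epsilon> powr (- p)"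
proof -
  have "1 \<le> \<epsilon> powr (- p)"
    using assms by (simp add: powr_minus field_simps powr_le1)
  then show "1 \<le> A_k0 p \<epsilon>" "real (A_k0 p \<epsilon>) \<le> \<epsilon> powr (- p)"
    by (simp_all add: A_k0_def le_nat_floor)
qed

lemma A_alpha_bounds:
  assumes "0 < \<epsilon>" "\<epsilon> < 1" "1 \<le> p" "0 < \<delta>" "\<delta> < 1"
  shows "0 < A_alpha p \<epsilon> \<delta>" "A_alpha p \<epsilon> \<delta> \<le> 1 / 2" "real (A_k0 p \<epsilon>) * A_alpha p \<epsilon> \<delta> = \<delta> / 2"
  using A_k0_bounds[OF assms(1-3)] assms by (simp_all add: A_alpha_def field_simps)

text \<open>By the identity, a remainder with norm at most \<epsilon>/\<gamma> around a coordinate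
  larger than \<epsilon> satisfies the hypothesis \<open>tail\<close> of
  \<open>spot_failure\<close>.\<close>

lemma A_gamma_bounds:
  assumes "0 < \<epsilon>" "\<epsilon> < 1" "1 \<le> p" "0 < \<delta>" "\<delta> < 1"
  shows "(A_gamma p \<epsilon> \<delta>)\<^sup>2 * A_alpha p \<epsilon> \<delta> ^ 3 = 2 * 2049\<^sup>2" "2049 \<le> A_gamma p \<epsilon> \<delta>"
proof -
  let ?a = "A_alpha p \<epsilon> \<delta>"
  note a = A_alpha_bounds[OF assms]
  have "(?a powr (- 3/2))\<^sup>2 = ?a powr (-3)"
    by (simp add: power2_eq_square powr_add[symmetric])
  also have "\<dots> * ?a ^ 3 = 1"
    using a by (simp add: powr_minus powr_numeral)
  finally have 1: "(?a powr (- 3/2))\<^sup>2 * ?a ^ 3 = 1" .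
  show "(A_gamma p \<epsilon> \<delta>)\<^sup>2 * ?a ^ 3 = 2 * 2049\<^sup>2"
    using 1 unfolding A_gamma_def power_mult_distrib by (simp add: mult.assoc)
  have "1 \<le> ?a powr (- 3/2)"
    using a by (simp add: powr_minus field_simps powr_le1)
  moreover have "1 \<le> sqrt 2" by simp
  ultimately have "2049 * 1 * 1 \<le> 2049 * sqrt 2 * ?a powr (- 3/2)"
    by (intro mult_mono) auto
  then show "2049 \<le> A_gamma p \<epsilon> \<delta>" by (simp add: A_gamma_def)
qed

lemma A_D_bounds:
  assumes "0 < \<epsilon>" "\<epsilon> < 1" "1 \<le> p" "0 < \<delta>" "\<delta> < 1"
  shows "(A_gamma p \<epsilon> \<delta> / \<epsilon>) powr p * real (A_k0 p \<epsilon>) / (\<delta> / 4) \<le> real (A_D p \<epsilon> \<delta>)"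
    and "1 \<le> A_D p \<epsilon> \<delta>"
proof -
  have pos: "0 < (A_gamma p \<epsilon> \<delta> / \<epsilon>) powr p * real (A_k0 p \<epsilon>) / (\<delta> / 4)"
    using A_gamma_bounds(2)[OF assms] A_k0_bounds[OF assms(1-3)] assms
    by (intro divide_pos_pos mult_pos_pos) auto
  then show *: "(A_gamma p \<epsilon> \<delta> / \<epsilon>) powr p * real (A_k0 p \<epsilon>) / (\<delta> / 4) \<le> real (A_D p \<epsilon> \<delta>)"
    by (simp add: A_D_def A_delta0_def)
  then show "1 \<le> A_D p \<epsilon> \<delta>" using pos by linarith
qed

text \<open>The second bound turns the failure probability in \<open>bs_failure\<close> into
  \<delta>/4.\<close>

lemma A_R_bounds:
  assumes "0 < \<epsilon>" "\<epsilon> < 1" "1 \<le> p" "0 < \<delta>" "\<delta> < 1"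
  shows "odd (A_R p \<epsilon> \<delta>)" "real (A_D p \<epsilon> \<delta>) / \<delta> \<le> 2 ^ (A_R p \<epsilon> \<delta> div 2)"
proof -
  define z where "z = real (A_D p \<epsilon> \<delta>) / (2 * A_delta1 \<delta>)"
  define c where "c = \<lceil>log 2 z - 1/2\<rceil>"
  have z: "z = 2 * (real (A_D p \<epsilon> \<delta>) / \<delta>)" by (simp add: z_def A_delta1_def)
  have "1 \<le> real (A_D p \<epsilon> \<delta>) / \<delta>"
    using A_D_bounds(2)[OF assms] assms by (simp add: field_simps)
  then have z2: "2 \<le> z" by (simp add: z)
  then have "1 \<le> log 2 z" by (simp add: le_log_iff)
  \<comment> \<open>Ensures that \<open>nat\<close> in the definition of \<open>A_R\<close>
    truncates nothing.\<close>
  then have c0: "0 \<le> c" by (simp add: c_def)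
  then have R: "A_R p \<epsilon> \<delta> = 2 * nat c + 1"
    by (simp add: A_R_def c_def z_def nat_add_distrib nat_mult_distrib)
  then show "odd (A_R p \<epsilon> \<delta>)" by simp
  have "real (A_D p \<epsilon> \<delta>) / \<delta> = 2 powr (log 2 z - 1)"
    using z2 by (simp add: z powr_diff)
  also have "\<dots> \<le> 2 powr real (nat c)"
    using c0 by (intro powr_mono) (auto simp: c_def, linarith)
  also have "\<dots> = 2 ^ (A_R p \<epsilon> \<delta> div 2)" by (simp add: R powr_realpow)
  finally show "real (A_D p \<epsilon> \<delta>) / \<delta> \<le> 2 ^ (A_R p \<epsilon> \<delta> div 2)" .
qed

lemma A_k_bounds:
  assumes "0 < \<epsilon>" "\<epsilon> < 1" "1 \<le> p"
  defines "y \<equiv> 2 powr (7 * p / 2) * \<epsilon> powr (- p)"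
  shows "real (A_k p \<epsilon>) \<le> y" "y \<le> 2 * real (A_k p \<epsilon>)" "1 \<le> A_k p \<epsilon>"
proof -
  have "1 \<le> \<epsilon> powr (- p)"
    using assms(1-3) by (simp add: powr_minus field_simps powr_le1)
  moreover have "1 \<le> (2::real) powr (7 * p / 2)"
    using assms(3) by (intro ge_one_powr_ge_zero) auto
  ultimately have "1 * 1 \<le> y"
    unfolding y_def by (intro mult_mono) auto
  then have y: "1 \<le> y" by simp
  then have "1 \<le> \<lfloor>y\<rfloor>" by simp
  moreover have "A_k p \<epsilon> = nat \<lfloor>y\<rfloor>" by (simp add: A_k_def y_def)
  ultimately have k: "int (A_k p \<epsilon>) = \<lfloor>y\<rfloor>" "1 \<le> A_k p \<epsilon>" by linarith+
  then have k': "real (A_k p \<epsilon>) = of_int \<lfloor>y\<rfloor>" by (metis of_int_of_nat_eq)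
  show "real (A_k p \<epsilon>) \<le> y" "y \<le> 2 * real (A_k p \<epsilon>)" "1 \<le> A_k p \<epsilon>"
    using k k' y floor_correct[of y] by linarith+
qed

text \<open>The noise budget 1/8 is split into 1/32 for the bucket itself and 3/32 for collisions.
  As G = 4k is at least twice the unrounded value of k, the claim reduces to 2^(7/2) \<ge> 32/3 and
  to p + 7/2 \<le> 1 + 7p/2, the latter by 1 \<le> p.\<close>

lemma A_G_bound:
  assumes "0 < \<epsilon>" "\<epsilon> < 1" "1 \<le> p"
  shows "(2 / \<epsilon>) powr p / real (A_G p \<epsilon>) \<le> 3 / 32"
proof -
  have pow: "(2::real) powr (7/2) = 8 * sqrt 2"
  proof -
    have "(2::real) powr (7/2) = 2 powr (3 + 1/2)" by simp
    also have "\<dots> = 8 * sqrt 2" unfolding powr_add by (simp add: powr_numeral powr_half_sqrt)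
    finally show ?thesis .
  qed
  have s: "4 / 3 \<le> sqrt 2" by (rule real_le_rsqrt) (simp add: power2_eq_square)
  have "(2 / \<epsilon>) powr p * (32 / 3) \<le> 2 powr p * \<epsilon> powr (- p) * 2 powr (7/2)"
    unfolding pow using assms s by (simp add: powr_divide powr_minus field_simps)
  also have "\<dots> = 2 powr (p + 7/2) * \<epsilon> powr (- p)"
    by (simp add: powr_add)
  also have "\<dots> \<le> 2 powr (1 + 7 * p / 2) * \<epsilon> powr (- p)"
    using assms by (intro mult_right_mono powr_mono) auto
  also have "\<dots> = 2 * (2 powr (7 * p / 2) * \<epsilon> powr (- p))" by (simp add: powr_add)
  also have "\<dots> \<le> 2 * (2 * real (A_k p \<epsilon>))"
    using A_k_bounds(2)[OF assms] by linarith
  also have "\<dots> = real (A_G p \<epsilon>)" by (simp add: A_G_def)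
  finally show ?thesis using A_k_bounds(3)[OF assms] by (simp add: A_G_def field_simps)
qed

section \<open>Failure probability\<close>

lemma A_error_prob:
  fixes x :: vec
  assumes p: "1 \<le> p" "p \<le> 2" and eps: "0 < \<epsilon>" "\<epsilon> < 1" and del: "0 < \<delta>" "\<delta> < 1" and m: "1 \<le> m"
    and inst: "A_instance m p \<epsilon> \<delta> sel hstar P" and x: "lp_norm p m x \<le> 1"
  shows "measure_pmf.prob P
           {s. linf_norm m (\<lambda>i. A_output sel hstar m p \<epsilon> \<delta> s x i - x i) > \<epsilon>} \<le> \<delta>"
proof -
  define D where "D = A_D p \<epsilon> \<delta>"
  define R where "R = A_R p \<epsilon> \<delta>"
  define \<alpha> where "\<alpha> = A_alpha p \<epsilon> \<delta>"
  define \<gamma> where "\<gamma> = A_gamma p \<epsilon> \<delta>"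
  define T where "T = \<epsilon> / 2"
  \<comment> \<open>The threshold for light buckets: the integer part of \<tau>^(-p) is
    \<open>A_k p \<epsilon>\<close>, and the squared ratio of \<tau> to \<open>T\<close> is
    1/32.\<close>
  define \<tau> where "\<tau> = \<epsilon> / 2 powr (7/2)"
  define I where "I = {i \<in> {1..m}. \<epsilon> < \<bar>x i\<bar>}"
  define tail where "tail h i = (\<Sum>j\<in>bucket m h (h i) - {i}. \<bar>x j\<bar> powr p)" for h i
  define good where "good h \<longleftrightarrow> (\<forall>i\<in>I. h i \<in> {1..D} \<and> tail h i \<le> (\<epsilon> / \<gamma>) powr p)" for h
  define light where "light h = {d. (\<Sum>j\<in>bucket m h d. \<bar>x j\<bar> powr p) \<le> \<tau> powr p}" for h
  \<comment> \<open>No important coordinate is named, so \<open>A h\<close> is a function of the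
    bucket index alone. For good \<open>h\<close> it is the heavy bucket without its important
    coordinate, see \<open>A_heavy\<close>.\<close>
  define A where "A h d = (if d \<in> light h then bucket m h d else {j \<in> bucket m h d. \<bar>x j\<bar> \<le> \<epsilon>})" for h d
  \<comment> \<open>The buckets whose medians must be controlled: light ones have to stay below
    \<open>T\<close>, those with an important coordinate have to exceed it.\<close>
  define crit where "crit h = (light h \<inter> {1..D}) \<union> (h ` I \<inter> {1..D})" for h
  let ?h = "main_params m"
  let ?Y = "\<lambda>s. (bs_params m D R s, spot_params m D s)"
  let ?n = "spot_steps m"
  have sel: "selection_rule D (A_k p \<epsilon>) sel" and inj: "injection_rule hstar"
    and main: "main_law m D P" and bs: "bs_law m D R (A_G p \<epsilon>) P"
    and sp: "\<And>d. d \<in> {1..D} \<Longrightarrow> spot_law m \<alpha> d P"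
    and ind: "indep_pair P ?h ?Y"
    using inst by (auto simp: A_instance_def seed_law_def Let_def D_def R_def \<alpha>_def)
  note par = eps p(1) del
  have a: "0 < \<alpha>" "\<alpha> \<le> 1 / 2" "real (A_k0 p \<epsilon>) * \<alpha> = \<delta> / 2"
    using A_alpha_bounds[OF par] by (simp_all add: \<alpha>_def)
  have g: "\<gamma>\<^sup>2 * \<alpha> ^ 3 = 2 * 2049\<^sup>2" "2049 \<le> \<gamma>"
    using A_gamma_bounds[OF par] by (simp_all add: \<gamma>_def \<alpha>_def)
  have T: "0 < T" "2 * T = \<epsilon>" using eps by (simp_all add: T_def)
  have tau: "0 < \<tau>" "\<tau>\<^sup>2 = \<epsilon>\<^sup>2 / 128" "\<tau> \<le> \<epsilon>" "\<epsilon> / \<gamma> \<le> \<tau>"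
  proof -
    show "0 < \<tau>" using eps by (simp add: \<tau>_def)
    have "((2::real) powr (7/2))\<^sup>2 = 2 powr 7" by (simp add: power2_eq_square powr_add[symmetric])
    then show sq: "\<tau>\<^sup>2 = \<epsilon>\<^sup>2 / 128" by (simp add: \<tau>_def power_divide powr_numeral)
    have "\<tau>\<^sup>2 \<le> \<epsilon>\<^sup>2" using sq zero_le_power2[of \<epsilon>] by linarith
    then show "\<tau> \<le> \<epsilon>" using eps by (simp add: power2_le_iff_abs_le)
    have "\<epsilon> / \<gamma> \<le> \<epsilon> / 2049" using g eps by (intro divide_left_mono) auto
    then have "(\<epsilon> / \<gamma>)\<^sup>2 \<le> (\<epsilon> / 2049)\<^sup>2" using eps g by (intro power_mono) auto
    also have "\<dots> \<le> \<tau>\<^sup>2" unfolding sq by (simp add: power_divide)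
    finally show "\<epsilon> / \<gamma> \<le> \<tau>" using \<open>0 < \<tau>\<close> by (auto intro: power2_le_imp_le)
  qed
  have eg: "0 < \<epsilon> / \<gamma>" using eps g by simp
  have px: "(\<Sum>i\<in>{1..m}. \<bar>x i\<bar> powr p) \<le> 1" by (rule lp_norm_le_1[OF x p(1)])
  have finb: "finite (bucket m h d)" "bucket m h d \<subseteq> {1..m}" for h d by (auto simp: bucket_def)
  have fI: "finite I" by (simp add: I_def)
  have cI: "real (card I) \<le> real (A_k0 p \<epsilon>)"
  proof -
    have "card I \<le> nat \<lfloor>1 / \<epsilon> powr p\<rfloor>"
    proof (rule card_large_groups[where f="\<lambda>i. \<bar>x i\<bar> powr p"])
      have "(\<Sum>i\<in>I. \<bar>x i\<bar> powr p) \<le> (\<Sum>i\<in>{1..m}. \<bar>x i\<bar> powr p)"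
        by (intro sum_mono2) (auto simp: I_def)
      then show "(\<Sum>i\<in>I. \<bar>x i\<bar> powr p) \<le> 1" using px by simp
    qed (use eps p fI in \<open>auto simp: I_def intro!: powr_less_mono2\<close>)
    then have "card I \<le> A_k0 p \<epsilon>" by (simp add: A_k0_def powr_minus divide_inverse)
    then show ?thesis by simp
  qed
  have nonlight: "card ({1..D} - light h) \<le> A_k p \<epsilon>" for h
  proof -
    have "card ({1..D} - light h) \<le> nat \<lfloor>1 / \<tau> powr p\<rfloor>"
    proof (rule card_large_groups[where f="\<lambda>d. \<Sum>j\<in>bucket m h d. \<bar>x j\<bar> powr p"])
      have "(\<Sum>d\<in>{1..D} - light h. \<Sum>j\<in>bucket m h d. \<bar>x j\<bar> powr p)
          = (\<Sum>j\<in>(\<Union>d\<in>{1..D} - light h. bucket m h d). \<bar>x j\<bar> powr p)"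
        by (rule sum.UNION_disjoint[symmetric]) (auto simp: bucket_def)
      also have "\<dots> \<le> (\<Sum>i\<in>{1..m}. \<bar>x i\<bar> powr p)"
        by (intro sum_mono2) (auto simp: bucket_def)
      finally show "(\<Sum>d\<in>{1..D} - light h. \<Sum>j\<in>bucket m h d. \<bar>x j\<bar> powr p) \<le> 1"
        using px by simp
    qed (use tau in \<open>auto simp: light_def\<close>)
    also have "1 / \<tau> powr p = 2 powr (7 * p / 2) * \<epsilon> powr (- p)"
      using eps by (simp add: \<tau>_def powr_divide powr_powr powr_minus field_simps)
    finally show ?thesis by (simp add: A_k_def)
  qed
  have h_range: "?h s i \<in> {1..D}" if "s \<in> set_pmf P" "i \<in> {1..m}" for s i
    using main that A_D_bounds(2)[OF par] uniform_rv_in[of P "\<lambda>s. main_hash s i" "{1..D}" s]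
    by (auto simp: main_law_def main_params_def D_def)

  have bad_hash: "measure_pmf.prob P {s. \<not> good (?h s)} \<le> \<delta> / 4"
  proof -
    have one: "measure_pmf.prob P {s. (\<epsilon> / \<gamma>) powr p \<le> tail (?h s) i} \<le> (\<gamma> / \<epsilon>) powr p / real D"
      if i: "i \<in> I" for i
    proof -
      have im: "i \<in> {1..m}" using i by (simp add: I_def)
      let ?c = "\<lambda>j s. of_bool (main_hash s j = main_hash s i) :: real"
      have ob: "integrable (measure_pmf P) (?c j)" for j
        by (rule integrable_pmf_bounded[where B=1]) auto
      \<comment> \<open>With collision indicators the expectation follows from pairwise independence
        and is at most 1/D. Markov's inequality and the choice of \<open>A_D\<close> then cover all
        coordinates in \<open>I\<close>.\<close>
      have tail_eq: "tail (?h s) i = (\<Sum>j\<in>{1..m} - {i}. \<bar>x j\<bar> powr p * ?c j s)" for s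
        unfolding tail_def bucket_main_params using im
        by (intro sum.mono_neutral_cong_left) (auto simp: bucket_def main_params_def)
      have int: "integrable (measure_pmf P) (\<lambda>s. tail (?h s) i)"
        unfolding tail_eq by (intro Bochner_Integration.integrable_sum integrable_mult_right ob)
      have "measure_pmf.expectation P (\<lambda>s. tail (?h s) i)
          = (\<Sum>j\<in>{1..m} - {i}. \<bar>x j\<bar> powr p * measure_pmf.expectation P (?c j))"
        unfolding tail_eq
        by (subst Bochner_Integration.integral_sum) (intro integrable_mult_right ob, simp)
      also have "\<dots> = (\<Sum>j\<in>{1..m} - {i}. \<bar>x j\<bar> powr p * (1 / real D))"
      proof (intro sum.cong refl arg_cong2[where f="(*)"])
        fix j assume j: "j \<in> {1..m} - {i}"
        have u: "uniform_rv P (\<lambda>s. main_hash s b) {1..D}" if "b \<in> {1..m}" for b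
          using main that by (auto simp: main_law_def)
        have "prob_space.indep_var (measure_pmf P) (count_space UNIV) (\<lambda>s. main_hash s j)
            (count_space UNIV) (\<lambda>s. main_hash s i)"
          using main j im by (auto simp: main_law_def pairwise_indep_def)
        from prob_collision[OF this u u] j im A_D_bounds(2)[OF par]
        have "measure_pmf.prob P {s. main_hash s j = main_hash s i} = 1 / real D"
          by (simp add: D_def)
        moreover have "measure_pmf.expectation P (?c j)
            = measure_pmf.expectation P (indicator {s. main_hash s j = main_hash s i})"
          by (intro Bochner_Integration.integral_cong) (auto simp: indicator_def)
        ultimately show "measure_pmf.expectation P (?c j) = 1 / real D" by simp
      qed
      also have "\<dots> = (\<Sum>j\<in>{1..m} - {i}. \<bar>x j\<bar> powr p) / real D"
        by (simp add: sum_divide_distrib)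
      also have "\<dots> \<le> (\<Sum>j\<in>{1..m}. \<bar>x j\<bar> powr p) / real D"
        by (intro divide_right_mono sum_mono2) auto
      also have "\<dots> \<le> 1 / real D" using px by (intro divide_right_mono) auto
      finally have E: "measure_pmf.expectation P (\<lambda>s. tail (?h s) i) \<le> 1 / real D" .
      have "measure_pmf.prob P {s. (\<epsilon> / \<gamma>) powr p \<le> tail (?h s) i}
          \<le> measure_pmf.expectation P (\<lambda>s. tail (?h s) i) / (\<epsilon> / \<gamma>) powr p"
        using eg by (intro pmf_markov int) (auto simp: tail_def sum_nonneg)
      also have "\<dots> \<le> (1 / real D) / (\<epsilon> / \<gamma>) powr p"
        using E by (intro divide_right_mono) auto
      also have "\<dots> = (\<gamma> / \<epsilon>) powr p / real D"
        using eps g by (simp add: powr_divide field_simps)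
      finally show ?thesis .
    qed
    have D0: "0 < real D" using A_D_bounds(2)[OF par] by (simp add: D_def)
    have "measure_pmf.prob P {s. \<not> good (?h s)}
        \<le> measure_pmf.prob P (\<Union>i\<in>I. {s. (\<epsilon> / \<gamma>) powr p \<le> tail (?h s) i})"
    proof (rule measure_pmf.finite_measure_mono_AE)
      show "AE s in measure_pmf P. s \<in> {s. \<not> good (?h s)} \<longrightarrow>
          s \<in> (\<Union>i\<in>I. {s. (\<epsilon> / \<gamma>) powr p \<le> tail (?h s) i})"
        unfolding AE_measure_pmf_iff
      proof (intro ballI impI)
        fix s assume s: "s \<in> set_pmf P" and "s \<in> {s. \<not> good (?h s)}"
        then obtain i where i: "i \<in> I" "\<not> (?h s i \<in> {1..D} \<and> tail (?h s) i \<le> (\<epsilon> / \<gamma>) powr p)"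
          unfolding good_def by blast
        moreover have "?h s i \<in> {1..D}" using i h_range[OF s, of i] by (simp add: I_def)
        ultimately have "(\<epsilon> / \<gamma>) powr p \<le> tail (?h s) i" by linarith
        then show "s \<in> (\<Union>i\<in>I. {s. (\<epsilon> / \<gamma>) powr p \<le> tail (?h s) i})"
          using i by blast
      qed
    qed simp
    also have "\<dots> \<le> (\<Sum>i\<in>I. measure_pmf.prob P {s. (\<epsilon> / \<gamma>) powr p \<le> tail (?h s) i})"
      using fI by (intro measure_UNION_le) auto
    also have "\<dots> \<le> (\<Sum>i\<in>I. (\<gamma> / \<epsilon>) powr p / real D)"
      using one by (intro sum_mono)
    also have "\<dots> = real (card I) * ((\<gamma> / \<epsilon>) powr p / real D)" by simp
    also have "\<dots> \<le> real (A_k0 p \<epsilon>) * ((\<gamma> / \<epsilon>) powr p / real D)"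
      using cI by (intro mult_right_mono) auto
    also have "\<dots> \<le> \<delta> / 4"
      using A_D_bounds(1)[OF par] D0 del by (simp add: D_def[symmetric] \<gamma>_def[symmetric] field_simps)
    finally show ?thesis .
  qed

  \<comment> \<open>A good hash vector also separates the important coordinates: the other entries
    of such a bucket are at most \<epsilon>/\<gamma>, hence at most \<epsilon>.\<close>
  have tail_abs: "\<bar>x j\<bar> \<le> \<epsilon>" if "good h" "i \<in> I" "j \<in> bucket m h (h i) - {i}" for h i j
  proof -
    have "\<bar>x j\<bar> \<le> \<epsilon> / \<gamma>"
      using that finb eg p
      by (intro sum_powr_le_imp_abs_le[where B="bucket m h (h i) - {i}" and p=p])
        (auto simp: good_def tail_def)
    then show ?thesis using tau by linarith
  qed
  have not_light: "h i \<notin> light h" if "i \<in> I" for h i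
  proof -
    have "\<tau> powr p < \<bar>x i\<bar> powr p"
      using that tau p by (intro powr_less_mono2) (auto simp: I_def)
    also have "\<dots> \<le> (\<Sum>j\<in>bucket m h (h i). \<bar>x j\<bar> powr p)"
      using that by (intro member_le_sum) (auto simp: I_def bucket_def)
    finally show ?thesis by (simp add: light_def)
  qed
  have A_heavy: "A h (h i) = bucket m h (h i) - {i}" if "good h" "i \<in> I" for h i
    using tail_abs[OF that] not_light[OF that(2)] that(2) by (auto simp: A_def I_def)
  have A_tail: "(\<Sum>j\<in>A h d. (x j)\<^sup>2) \<le> \<tau>\<^sup>2" if "good h" "d \<in> crit h" for h d
  proof (cases "d \<in> light h")
    case True
    then show ?thesis
      using finb tau p by (intro sum_squares_le[where p=p]) (auto simp: A_def light_def)
  next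
    case False
    with that(2) obtain i where i: "i \<in> I" "d = h i" by (auto simp: crit_def)
    have "(\<Sum>j\<in>A h d. (x j)\<^sup>2) \<le> (\<epsilon> / \<gamma>)\<^sup>2"
      unfolding i(2) A_heavy[OF that(1) i(1)]
      using that i finb eg p by (intro sum_squares_le[where p=p]) (auto simp: good_def tail_def)
    also have "\<dots> \<le> \<tau>\<^sup>2" using tau eg by (intro power_mono) auto
    finally show ?thesis .
  qed

  let ?bs = "\<lambda>h y. \<exists>d\<in>crit h. bs_bad m D R h x T d (A h d) (fst (fst y)) (snd (fst y))"
  \<comment> \<open>The sets \<open>crit h\<close> and \<open>A h d\<close> depend on the main hash
    vector only, so they stay fixed while the parameters in \<open>?Y\<close> are averaged.\<close>
  have bad_select: "measure_pmf.prob P {s. good (?h s) \<and> ?bs (?h s) (?Y s)} \<le> \<delta> / 4"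
  proof (rule indep_pair_prob_le_const[OF ind])
    fix s assume gs: "good (?h s)"
    let ?hs = "?h s"
    have "measure_pmf.prob P {t. \<exists>d\<in>crit ?hs. bs_bad m D R ?hs x T d (A ?hs d)
        (bs_hashes D R t) (bs_signs m R t)} \<le> real D / (4 * 2 ^ (R div 2))"
    proof (rule bs_failure[OF bs _ _ T(1) p])
      show "1 \<le> A_G p \<epsilon>" using A_k_bounds(3)[OF eps p(1)] by (simp add: A_G_def)
      show "odd R" using A_R_bounds(1)[OF par] by (simp add: R_def)
      show "crit ?hs \<subseteq> {1..D}" by (auto simp: crit_def)
      fix d assume d: "d \<in> crit ?hs"
      show "A ?hs d \<subseteq> bucket m ?hs d" by (auto simp: A_def)
      have "(\<Sum>j\<in>A ?hs d. (x j)\<^sup>2) / T\<^sup>2 \<le> \<tau>\<^sup>2 / T\<^sup>2"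
        using A_tail[OF gs d] by (intro divide_right_mono) auto
      also have "\<dots> = 1 / 32" using eps by (simp add: tau T_def power_divide)
      finally have 1: "(\<Sum>j\<in>A ?hs d. (x j)\<^sup>2) / T\<^sup>2 \<le> 1 / 32" .
      have "(\<Sum>j\<in>{1..m}. (\<bar>x j\<bar> / T) powr p) = (\<Sum>j\<in>{1..m}. \<bar>x j\<bar> powr p) * (2 / \<epsilon>) powr p"
        unfolding sum_distrib_right using eps
        by (intro sum.cong refl) (simp add: T_def powr_divide powr_mult)
      also have "\<dots> \<le> 1 * (2 / \<epsilon>) powr p"
        using px by (intro mult_right_mono) auto
      finally have "(\<Sum>j\<in>{1..m}. (\<bar>x j\<bar> / T) powr p) / real (A_G p \<epsilon>) \<le> (2 / \<epsilon>) powr p / real (A_G p \<epsilon>)"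
        by (intro divide_right_mono) auto
      also have "\<dots> \<le> 3 / 32" by (rule A_G_bound[OF eps p(1)])
      finally show "(\<Sum>j\<in>A ?hs d. (x j)\<^sup>2) / T\<^sup>2
          + (\<Sum>j\<in>{1..m}. (\<bar>x j\<bar> / T) powr p) / real (A_G p \<epsilon>) \<le> 1 / 8"
        using 1 by linarith
    qed
    also have "\<dots> \<le> \<delta> / 4"
      using A_R_bounds(2)[OF par] del by (simp add: D_def R_def field_simps)
    finally show "measure_pmf.prob P {t. ?bs ?hs (?Y t)} \<le> \<delta> / 4"
      by (simp add: bs_params_def)
  qed (use del in auto)

  let ?sp = "\<lambda>i h y. \<exists>k\<le>?n. spot_bad hstar m x (bucket m h (h i)) i k
      (fst (snd y (h i))) (snd (snd y (h i)))"
  \<comment> \<open>For a frozen hash vector the index \<open>h i\<close> of the call of Spot is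
    fixed, so \<open>spot_law\<close> for this one index applies.\<close>
  have bad_spot: "measure_pmf.prob P {s. good (?h s) \<and> ?sp i (?h s) (?Y s)} \<le> \<alpha>"
    if i: "i \<in> I" for i
  proof (rule indep_pair_prob_le_const[OF ind])
    fix s assume gs: "good (?h s)"
    let ?hs = "?h s"
    have d: "?hs i \<in> {1..D}" using gs i by (auto simp: good_def)
    have "measure_pmf.prob P {t. \<exists>k\<le>?n. spot_bad hstar m x (bucket m ?hs (?hs i)) i k
        (spot_hashes m (?hs i) t) (spot_signs m (?hs i) t)} \<le> \<alpha>"
    proof (rule spot_failure[OF sp[OF d] inj a(1,2) finb(2)])
      show "i \<in> bucket m ?hs (?hs i)" "x i \<noteq> 0" using i eps by (auto simp: I_def bucket_def)
      have "(\<Sum>j\<in>bucket m ?hs (?hs i) - {i}. (x j)\<^sup>2) \<le> (\<epsilon> / \<gamma>)\<^sup>2"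
        using gs i finb eg p by (intro sum_squares_le[where p=p]) (auto simp: good_def tail_def)
      then have "\<gamma>\<^sup>2 * (\<Sum>j\<in>bucket m ?hs (?hs i) - {i}. (x j)\<^sup>2) \<le> \<gamma>\<^sup>2 * (\<epsilon> / \<gamma>)\<^sup>2"
        by (intro mult_left_mono) auto
      also have "\<dots> = \<epsilon>\<^sup>2" using g by (simp add: power_divide)
      also have "\<dots> \<le> (x i)\<^sup>2"
        using i eps by (simp add: I_def power2_le_iff_abs_le abs_le_square_iff[symmetric])
      finally have "\<alpha> ^ 3 * (\<gamma>\<^sup>2 * (\<Sum>j\<in>bucket m ?hs (?hs i) - {i}. (x j)\<^sup>2)) \<le> \<alpha> ^ 3 * (x i)\<^sup>2"
        using a by (intro mult_left_mono) auto
      then show "2 * 2049\<^sup>2 * (\<Sum>j\<in>bucket m ?hs (?hs i) - {i}. (x j)\<^sup>2) \<le> \<alpha> ^ 3 * (x i)\<^sup>2"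
        unfolding g(1)[symmetric] by (simp only: mult_ac)
    qed
    then show "measure_pmf.prob P {t. ?sp i ?hs (?Y t)} \<le> \<alpha>"
      using d by (simp add: spot_params_def)
  qed (use a in auto)

  \<comment> \<open>Outside the exceptional events every coordinate of \<open>I\<close> is observed.
    Each remaining coordinate contributes at most \<epsilon> even if it is replaced by 0.\<close>
  have correct: "linf_norm m (\<lambda>i. A_output sel hstar m p \<epsilon> \<delta> s x i - x i) \<le> \<epsilon>"
    if s: "s \<in> set_pmf P" and gs: "good (?h s)" and nbs: "\<not> ?bs (?h s) (?Y s)"
      and nsp: "\<And>i. i \<in> I \<Longrightarrow> \<not> ?sp i (?h s) (?Y s)" for s
  proof -
    let ?hs = "?h s" and ?mh = "main_hash s"
    let ?K = "A_candidates sel hstar m p \<epsilon> \<delta> s x"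
    have "i \<in> ?K" if i: "i \<in> I" for i
    proof -
      have im: "i \<in> {1..m}" using i by (simp add: I_def)
      define d where "d = ?mh i"
      have hd: "?hs i = d" using im by (simp add: main_params_def d_def)
      have d: "d \<in> {1..D}" using gs i hd by (auto simp: good_def)
      have ib: "i \<in> bucket m ?mh d" using im by (simp add: bucket_def d_def)
      have nb: "\<not> bs_bad m D R ?mh x T d' (A ?hs d') (group_hash s) (\<lambda>(r, j). bs_sign s r j)"
        if "d' \<in> crit ?hs" for d'
      proof -
        have "A ?hs d' \<subseteq> {1..m}" "d' \<in> {1..D}"
          using that by (auto simp: A_def bucket_def crit_def)
        then show ?thesis
          using nbs that by (auto simp: bs_params_def bs_bad_main_params bs_bad_restrict)
      qed
      have "d \<in> bucket_select sel m D R ?mh (group_hash s) (bs_sign s) x"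
      proof (rule bucket_select_contains[OF sel _ d ib, where T=T and L="light ?hs"])
        show "odd R" using A_R_bounds(1)[OF par] by (simp add: R_def)
        show "2 * T < \<bar>x i\<bar>" using i T by (simp add: I_def)
        show "\<bar>bs_sign s r i\<bar> = 1" if r: "r \<in> {1..R}" for r
        proof -
          have "uniform_rv P (\<lambda>s. bs_signs m R s (r, i)) {-1, 1}"
            using bs r im by (auto simp: bs_law_def)
          from uniform_sign_cases[OF this s] r im show ?thesis by (auto simp: bs_signs_def)
        qed
        show "d \<notin> light ?hs" using not_light[OF i, of ?hs] hd by simp
        show "card ({1..D} - light ?hs) \<le> A_k p \<epsilon>" by (rule nonlight)
        have "d \<in> crit ?hs" using i d hd by (auto simp: crit_def)
        from nb[OF this] A_heavy[OF gs i]
        show "\<not> bs_bad m D R ?mh x T d (bucket m ?mh d - {i}) (group_hash s) (\<lambda>(r, j). bs_sign s r j)"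
          by (simp add: hd bucket_main_params)
        fix d' assume d': "d' \<in> light ?hs \<inter> {1..D}"
        then have "d' \<in> crit ?hs" by (simp add: crit_def)
        from nb[OF this] d'
        show "\<not> bs_bad m D R ?mh x T d' (bucket m ?mh d') (group_hash s) (\<lambda>(r, j). bs_sign s r j)"
          by (simp add: A_def bucket_main_params)
      qed
      moreover have "i \<in> spot hstar m \<alpha> (spot_hash s d) (spot_sign s d) x (bucket m ?mh d)"
      proof (rule spot_contains[OF finb(1) ib])
        fix k assume k: "k \<le> ?n"
        then have "\<not> spot_bad hstar m x (bucket m ?mh d) i k (spot_hashes m d s) (spot_signs m d s)"
          using nsp[OF i] d hd by (auto simp: spot_params_def bucket_main_params)
        then show "\<not> spot_bad hstar m x (bucket m ?mh d) i k (spot_hash s d) (spot_sign s d)"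
          using spot_bad_restrict[OF finb(2) ib k] by simp
      qed
      ultimately show "i \<in> ?K"
        by (auto simp: A_candidates_def A_select_def D_def R_def \<alpha>_def)
    qed
    then have "\<bar>A_output sel hstar m p \<epsilon> \<delta> s x i - x i\<bar> \<le> \<epsilon>" if "i \<in> {1..m}" for i
      using that eps by (force simp: A_output_def I_def not_less)
    then show ?thesis
      unfolding linf_norm_def using m by (subst Max_le_iff) auto
  qed

  \<comment> \<open>The three events cost \<delta>/4, \<delta>/4 and \<open>card I\<close> times
    \<alpha>, the last being at most \<delta>/2.\<close>
  let ?E1 = "{s. \<not> good (?h s)}" and ?E2 = "{s. good (?h s) \<and> ?bs (?h s) (?Y s)}"
  let ?E3 = "\<Union>i\<in>I. {s. good (?h s) \<and> ?sp i (?h s) (?Y s)}"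
  have "measure_pmf.prob P {s. linf_norm m (\<lambda>i. A_output sel hstar m p \<epsilon> \<delta> s x i - x i) > \<epsilon>}
      \<le> measure_pmf.prob P (?E1 \<union> ?E2 \<union> ?E3)"
  proof (rule measure_pmf.finite_measure_mono_AE)
    show "AE s in measure_pmf P.
        s \<in> {s. linf_norm m (\<lambda>i. A_output sel hstar m p \<epsilon> \<delta> s x i - x i) > \<epsilon>} \<longrightarrow>
        s \<in> ?E1 \<union> ?E2 \<union> ?E3"
      unfolding AE_measure_pmf_iff
    proof (intro ballI impI)
      fix s assume s: "s \<in> set_pmf P"
        and "s \<in> {s. linf_norm m (\<lambda>i. A_output sel hstar m p \<epsilon> \<delta> s x i - x i) > \<epsilon>}"
      then have "\<not> linf_norm m (\<lambda>i. A_output sel hstar m p \<epsilon> \<delta> s x i - x i) \<le> \<epsilon>" by simp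
      with correct[OF s] show "s \<in> ?E1 \<union> ?E2 \<union> ?E3" by blast
    qed
  qed simp
  also have "\<dots> \<le> measure_pmf.prob P ?E1 + measure_pmf.prob P ?E2 + measure_pmf.prob P ?E3"
    by (rule order_trans[OF measure_Un_le add_right_mono[OF measure_Un_le]]) auto
  also have "measure_pmf.prob P ?E3 \<le> (\<Sum>i\<in>I. measure_pmf.prob P {s. good (?h s) \<and> ?sp i (?h s) (?Y s)})"
    using fI by (intro measure_UNION_le) auto
  also have "\<dots> \<le> (\<Sum>i\<in>I. \<alpha>)" using bad_spot by (intro sum_mono)
  also have "\<dots> \<le> \<delta> / 2"
    using mult_right_mono[OF cI, of \<alpha>] a by simp
  also note bad_hash
  also note bad_select
  finally show ?thesis by simp
qed

section \<open>Cost\<close>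

text \<open>BucketSelect contributes R G with G = 4k, each selected bucket at most two functionals
  for each of \<open>Suc (spot_steps m)\<close> steps, and by \<open>card_spot_le\<close> at most
  one final observation.\<close>

lemma length_A_queries:
  assumes sel: "selection_rule (A_D p \<epsilon> \<delta>) (A_k p \<epsilon>) sel" and inj: "injection_rule hstar"
  shows "length (A_queries sel hstar m p \<epsilon> \<delta> s x)
           \<le> A_k p \<epsilon> * (4 * A_R p \<epsilon> \<delta> + 2 * spot_steps m + 3)"
proof -
  let ?S = "A_select sel m p \<epsilon> \<delta> s x" and ?K = "A_candidates sel hstar m p \<epsilon> \<delta> s x"
  let ?J = "\<lambda>d. bucket m (main_hash s) d"
  let ?spot = "\<lambda>d. spot hstar m (A_alpha p \<epsilon> \<delta>) (spot_hash s d) (spot_sign s d) x (?J d)"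
  let ?q = "\<lambda>d. spot_queries hstar m (A_alpha p \<epsilon> \<delta>) (spot_hash s d) (spot_sign s d) x (?J d)"
  have S: "?S \<subseteq> {1..A_D p \<epsilon> \<delta>}" "card ?S = A_k p \<epsilon>"
    using sel unfolding selection_rule_def A_select_def bucket_select_def by blast+
  then have fS: "finite ?S" using finite_subset by blast
  have "card ?K \<le> (\<Sum>d\<in>?S. card (?spot d))"
    unfolding A_candidates_def by (rule card_UN_le[OF fS])
  also have "\<dots> \<le> (\<Sum>d\<in>?S. 1)"
    by (intro sum_mono card_spot_le[OF inj]) (simp add: bucket_def)
  finally have K: "card ?K \<le> A_k p \<epsilon>" using S by simp
  have "(\<Sum>d\<leftarrow>sorted_list_of_set ?S. length (?q d))
      \<le> (\<Sum>d\<leftarrow>sorted_list_of_set ?S. 2 * Suc (spot_steps m))"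
    by (intro sum_list_mono length_spot_queries)
  also have "\<dots> = A_k p \<epsilon> * (2 * Suc (spot_steps m))"
    using S by (simp add: sum_list_triv)
  finally have Q: "(\<Sum>d\<leftarrow>sorted_list_of_set ?S. length (?q d)) \<le> A_k p \<epsilon> * (2 * Suc (spot_steps m))" .
  have "length (A_queries sel hstar m p \<epsilon> \<delta> s x)
      = A_R p \<epsilon> \<delta> * A_G p \<epsilon> + (\<Sum>d\<leftarrow>sorted_list_of_set ?S. length (?q d)) + card ?K"
    by (simp add: A_queries_def length_concat comp_def sum_list_triv del: upt_Suc)
  then show ?thesis using K Q by (simp add: A_G_def algebra_simps)
qed

section \<open>Logarithmic bounds on the parameters and the cost constant\<close>

text \<open>D is polynomially bounded in 1/\<epsilon> and 1/\<delta>. With a and b their logarithms,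
  ln k_0 is at most 2a and ln \<gamma> at most 3a + 3b/2 up to a constant, so p \<le> 2 gives the
  coefficients 2 (3 + 1) + 2 = 10 and 2 (3/2) + 1 = 4.\<close>

lemma ln_A_D_le:
  assumes p: "1 \<le> p" "p \<le> 2" and eps: "0 < \<epsilon>" "\<epsilon> < 1" and del: "0 < \<delta>" "\<delta> < 1"
  shows "ln (real (A_D p \<epsilon> \<delta>))
    \<le> (2 * ln (2049 * sqrt 2) + 6 * ln 2) + 10 * ln (1 / \<epsilon>) + 4 * ln (1 / \<delta>)"
proof -
  define a where "a = ln (1 / \<epsilon>)"
  define b where "b = ln (1 / \<delta>)"
  define k0 where "k0 = real (A_k0 p \<epsilon>)"
  define \<alpha> where "\<alpha> = A_alpha p \<epsilon> \<delta>"
  define \<gamma> where "\<gamma> = A_gamma p \<epsilon> \<delta>"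
  define y where "y = (\<gamma> / \<epsilon>) powr p * k0 / (\<delta> / 4)"
  note par = eps p(1) del
  have a: "0 \<le> a" "ln \<epsilon> = - a" using eps by (simp_all add: a_def ln_div)
  have b: "0 \<le> b" "ln \<delta> = - b" using del by (simp_all add: b_def ln_div)
  have k0: "1 \<le> k0" using A_k0_bounds(1)[OF eps p(1)] by (simp add: k0_def)
  have "ln k0 \<le> ln (\<epsilon> powr (- p))"
    using k0 A_k0_bounds(2)[OF eps p(1)] unfolding k0_def by (intro ln_mono) auto
  also have "\<dots> = p * a" using eps a by (simp add: ln_powr)
  also have "\<dots> \<le> 2 * a" using p a by (intro mult_right_mono) auto
  finally have lk0: "ln k0 \<le> 2 * a" .
  have \<alpha>: "0 < \<alpha>" using A_alpha_bounds[OF par] by (simp add: \<alpha>_def)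
  have "ln \<alpha> = ln \<delta> - ln (2 * k0)"
    unfolding \<alpha>_def A_alpha_def k0_def[symmetric] using del k0 by (subst ln_div) auto
  also have "\<dots> = - b - ln 2 - ln k0" using k0 b by (simp add: ln_mult)
  finally have l\<alpha>: "- ln \<alpha> \<le> ln 2 + 2 * a + b" using lk0 by linarith
  have \<gamma>: "2049 \<le> \<gamma>" using A_gamma_bounds(2)[OF par] by (simp add: \<gamma>_def)
  have "ln \<gamma> = ln (2049 * sqrt 2) + (- 3/2) * ln \<alpha>"
    unfolding \<gamma>_def A_gamma_def \<alpha>_def[symmetric] using \<alpha> by (simp add: ln_mult ln_powr)
  moreover have "(- 3/2) * ln \<alpha> \<le> 3 / 2 * (ln 2 + 2 * a + b)" using l\<alpha> by simp
  ultimately have l\<gamma>: "ln \<gamma> \<le> ln (2049 * sqrt 2) + 3 / 2 * (ln 2 + 2 * a + b)" by simp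
  have l\<gamma>0: "0 \<le> ln \<gamma>" using \<gamma> by simp
  have ypos: "0 < y" using \<gamma> eps k0 del by (auto simp: y_def)
  have "ln y = p * (ln \<gamma> + a) + ln k0 - (ln \<delta> - ln 4)"
    unfolding y_def using \<gamma> eps k0 del a by (simp add: ln_div ln_mult ln_powr)
  also have "\<dots> \<le> 2 * (ln \<gamma> + a) + ln k0 + b + ln 4"
    using mult_right_mono[OF p(2), of "ln \<gamma> + a"] l\<gamma>0 a b by linarith
  also have "ln (4::real) = 2 * ln 2" using ln_realpow[of 2 2] by simp
  finally have ly0: "ln y \<le> 2 * (ln \<gamma> + a) + ln k0 + b + 2 * ln 2" .
  have ly: "ln y \<le> 2 * ln (2049 * sqrt 2) + 5 * ln 2 + 10 * a + 4 * b"
  proof -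
    \<comment> \<open>With real variables in place of the logarithms the estimate is purely
      linear.\<close>
    have "u \<le> 2 * L + 5 * l + 10 * a + 4 * b"
      if "u \<le> 2 * (g + a) + k + b + 2 * l" "g \<le> L + 3 / 2 * (l + 2 * a + b)" "k \<le> 2 * a"
      for u g k L l :: real
      using that by (simp add: field_simps)
    from this[OF ly0 l\<gamma> lk0] show ?thesis .
  qed
  \<comment> \<open>Lets the rounding in \<open>A_D\<close> be absorbed by y + 1 \<le> 2y, at the
    price of one more \<open>ln 2\<close>.\<close>
  have "1 \<le> y"
  proof -
    have "1 \<le> (\<gamma> / \<epsilon>) powr p" using \<gamma> eps p by (intro ge_one_powr_ge_zero) (auto simp: field_simps)
    then have "1 * 1 \<le> (\<gamma> / \<epsilon>) powr p * k0" using k0 by (intro mult_mono) auto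
    then show ?thesis using del by (simp add: y_def field_simps)
  qed
  moreover have "real (A_D p \<epsilon> \<delta>) \<le> y + 1"
    using ypos by (simp add: A_D_def A_delta0_def y_def \<gamma>_def k0_def)
  ultimately have "real (A_D p \<epsilon> \<delta>) \<le> 2 * y" by linarith
  then have "ln (real (A_D p \<epsilon> \<delta>)) \<le> ln (2 * y)"
    using A_D_bounds(2)[OF par] by simp
  also have "\<dots> = ln 2 + ln y" using ypos by (simp add: ln_mult)
  finally show ?thesis using ly by (simp add: a_def b_def)
qed

lemma A_R_le:
  assumes "1 \<le> p" "0 < \<epsilon>" "\<epsilon> < 1" "0 < \<delta>" "\<delta> < 1"
  shows "real (A_R p \<epsilon> \<delta>) \<le> 2 / ln 2 * (ln (real (A_D p \<epsilon> \<delta>)) + ln (1 / \<delta>)) + 4"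
proof -
  define z where "z = real (A_D p \<epsilon> \<delta>) / (2 * A_delta1 \<delta>)"
  have D: "1 \<le> real (A_D p \<epsilon> \<delta>)" using A_D_bounds(2)[of \<epsilon> p \<delta>] assms by simp
  have z: "z = 2 * (real (A_D p \<epsilon> \<delta>) / \<delta>)" by (simp add: z_def A_delta1_def)
  have z2: "2 \<le> z" using D assms by (simp add: z field_simps)
  then have l: "1 \<le> log 2 z" by (simp add: le_log_iff)
  have "real (A_R p \<epsilon> \<delta>) \<le> 2 * log 2 z + 2"
    using l unfolding A_R_def z_def[symmetric] by linarith
  also have "log 2 z = 1 + (ln (real (A_D p \<epsilon> \<delta>)) + ln (1 / \<delta>)) / ln 2"
    using D assms by (simp add: z log_def ln_mult ln_div field_simps)
  finally show ?thesis by simp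
qed

text \<open>From 16 \<le> m follows ln m \<ge> 1, so the double logarithm is nonnegative and the
  bound survives the cut-off at 0 in \<open>spot_steps\<close>. Replacing log_2 m / 8 by ln m uses 8
  ln 2 \<ge> 1.\<close>

lemma spot_steps_le:
  assumes "16 \<le> m"
  shows "real (spot_steps m) \<le> ln (ln (real m)) / ln (9/8) + 1" "0 \<le> ln (ln (real m))"
proof -
  have "exp 1 \<le> (16::real)" using exp_le by linarith
  also have "\<dots> \<le> real m" using assms by simp
  finally have ln1: "1 \<le> ln (real m)" using assms by (simp add: ln_ge_iff)
  then show c: "0 \<le> ln (ln (real m))" by simp
  have l2: "1 / 2 \<le> ln (2::real)" using ln2_ge_two_thirds by simp
  let ?y = "log 2 (real m) / 8"
  have y: "0 < ?y" using assms by simp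
  have "?y \<le> ln (real m)"
    using l2 ln1 by (simp add: log_def field_simps)
  then have "ln ?y \<le> ln (ln (real m))" using y ln1 by simp
  then have "log (9/8) ?y \<le> ln (ln (real m)) / ln (9/8)"
    unfolding log_def by (intro divide_right_mono) auto
  then show "real (spot_steps m) \<le> ln (ln (real m)) / ln (9/8) + 1"
  proof -
    have "real (nat (max 0 \<lceil>w\<rceil>)) \<le> v + 1" if "w \<le> v" "0 \<le> v" for w v :: real
      using that by linarith
    moreover have "0 \<le> ln (ln (real m)) / ln (9/8)" using c by simp
    ultimately show ?thesis
      using \<open>log (9/8) ?y \<le> _\<close> assms by (simp add: spot_steps_def)
  qed
qed

text \<open>Collects the coefficients of \<open>A_card_bound\<close>. The part free of logarithms,
  with 21 = 16 + 2 + 3, is divided by \<open>ln 2\<close> because it is absorbed into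
  ln(1/\<epsilon>) \<ge> ln 2.\<close>

definition card_const :: "real \<Rightarrow> real" where
  "card_const p = 2 powr (7 * p / 2) *
     ((8 / ln 2 * (2 * ln (2049 * sqrt 2) + 6 * ln 2) + 21) / ln 2 + 80 / ln 2 + 2 / ln (9/8))"

lemma gamma_const_ge_1: "1 \<le> 2049 * sqrt (2::real)"
proof -
  have "1 \<le> sqrt (2::real)" by simp
  then show ?thesis by linarith
qed

lemma card_const_pos: "0 < card_const p"
proof -
  have "0 \<le> ln (2049 * sqrt (2::real))" using gamma_const_ge_1 by (rule ln_ge_zero)
  then show ?thesis
    unfolding card_const_def
    by (intro mult_pos_pos add_pos_pos add_nonneg_pos divide_pos_pos mult_nonneg_nonneg add_nonneg_nonneg) auto
qed

lemma A_card_bound: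
  assumes p: "1 \<le> p" "p \<le> 2" and eps: "0 < \<epsilon>" "\<epsilon> < 1/2" and del: "0 < \<delta>" "\<delta> < 1/2" and m: "16 \<le> m"
  shows "real (A_k p \<epsilon> * (4 * A_R p \<epsilon> \<delta> + 2 * spot_steps m + 3))
    \<le> card_const p * (ln (1 / \<delta>) + ln (1 / \<epsilon>) + ln (ln (real m))) * \<epsilon> powr (- p)"
proof -
  define a where "a = ln (1 / \<epsilon>)"
  define b where "b = ln (1 / \<delta>)"
  define c where "c = ln (ln (real m))"
  define K where "K = 2 * ln (2049 * sqrt 2) + 6 * ln 2"
  define K1 where "K1 = 8 / ln 2 * K + 21"
  have eps1: "\<epsilon> < 1" and del1: "\<delta> < 1" using eps del by auto
  have l2: "0 < ln (2::real)" "0 < ln (9/8::real)" by auto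
  have a: "ln 2 \<le> a" unfolding a_def using eps by (intro ln_mono) (auto simp: field_simps)
  then have a0: "0 \<le> a" using l2 by linarith
  have b: "0 \<le> b" using del1 del by (simp add: b_def ln_div)
  have c: "0 \<le> c" using spot_steps_le[OF m] by (simp add: c_def)
  have K: "0 \<le> K" using gamma_const_ge_1 by (simp add: K_def)
  then have K1: "0 \<le> K1" using l2 by (simp add: K1_def)
  have "real (A_R p \<epsilon> \<delta>) \<le> 2 / ln 2 * (K + 10 * a + 4 * b + b) + 4"
  proof -
    have "ln (real (A_D p \<epsilon> \<delta>)) + b \<le> K + 10 * a + 4 * b + b"
      using ln_A_D_le[OF p eps(1) eps1 del(1) del1] by (simp add: K_def a_def b_def)
    then have "2 / ln 2 * (ln (real (A_D p \<epsilon> \<delta>)) + b) \<le> 2 / ln 2 * (K + 10 * a + 4 * b + b)"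
      using l2 by (intro mult_left_mono) auto
    then show ?thesis using A_R_le[OF p(1) eps(1) eps1 del(1) del1] by (simp add: b_def)
  qed
  then have "4 * real (A_R p \<epsilon> \<delta>) + 2 * real (spot_steps m) + 3
      \<le> 4 * (2 / ln 2 * (K + 10 * a + 4 * b + b) + 4) + 2 * (c / ln (9/8) + 1) + 3"
    using spot_steps_le(1)[OF m, folded c_def]
    by (intro add_mono mult_left_mono order_refl) auto
  also have "\<dots> = K1 + 80 / ln 2 * a + 40 / ln 2 * b + 2 / ln (9/8) * c"
    by (simp add: K1_def algebra_simps)
  also have "\<dots> \<le> (K1 / ln 2 + 80 / ln 2 + 2 / ln (9/8)) * (b + a + c)"
  proof -
    have "K1 = K1 / ln 2 * ln 2" by simp
    also have "\<dots> \<le> K1 / ln 2 * a" using a K1 l2 by (intro mult_left_mono) auto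
    finally have "K1 \<le> K1 / ln 2 * a" .
    moreover have "40 / ln 2 * b \<le> 80 / ln 2 * b"
      using b l2 by (intro mult_right_mono divide_right_mono) auto
    moreover have "0 \<le> K1 / ln 2 * (b + c)" "0 \<le> 80 / ln 2 * c" "0 \<le> 2 / ln (9/8) * (a + b)"
      using a0 b c K1 l2 by auto
    moreover have "(u + v + w) * (b + a + c) = u * a + u * (b + c) + v * a + v * b + v * c + w * (a + b) + w * c"
      for u v w :: real by (simp add: algebra_simps)
    ultimately show ?thesis by simp
  qed
  finally have main: "4 * real (A_R p \<epsilon> \<delta>) + 2 * real (spot_steps m) + 3
      \<le> (K1 / ln 2 + 80 / ln 2 + 2 / ln (9/8)) * (b + a + c)" .
  have "real (A_k p \<epsilon> * (4 * A_R p \<epsilon> \<delta> + 2 * spot_steps m + 3))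
      = real (A_k p \<epsilon>) * (4 * real (A_R p \<epsilon> \<delta>) + 2 * real (spot_steps m) + 3)"
    by simp
  also have "\<dots> \<le> (2 powr (7 * p / 2) * \<epsilon> powr (- p)) *
      ((K1 / ln 2 + 80 / ln 2 + 2 / ln (9/8)) * (b + a + c))"
    using A_k_bounds(1)[OF eps(1) eps1 p(1)] main by (intro mult_mono) auto
  also have "\<dots> = card_const p * (b + a + c) * \<epsilon> powr (- p)"
    by (simp only: card_const_def K1_def K_def mult_ac)
  finally show ?thesis by (simp add: a_def b_def c_def)
qed

theorem theorem3p1:
  fixes p :: real
  assumes "1 \<le> p" and "p \<le> 2"
  shows "(\<forall>(m::nat) (\<epsilon>::real) (\<delta>::real) sel hstar P.
            1 \<le> m \<longrightarrow> 0 < \<epsilon> \<longrightarrow> \<epsilon> < 1 \<longrightarrow> 0 < \<delta> \<longrightarrow> \<delta> < 1 \<longrightarrow>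
            A_instance m p \<epsilon> \<delta> sel hstar P \<longrightarrow>
            (SUP x\<in>{x. lp_norm p m x \<le> 1}.
               measure_pmf.prob P
                 {s. linf_norm m (\<lambda>i. A_output sel hstar m p \<epsilon> \<delta> s x i - x i) > \<epsilon>}) \<le> \<delta>)
       \<and> (\<exists>C>0. \<forall>(m::nat) (\<epsilon>::real) (\<delta>::real) sel hstar P.
            16 \<le> m \<longrightarrow> 0 < \<epsilon> \<longrightarrow> \<epsilon> < 1/2 \<longrightarrow> 0 < \<delta> \<longrightarrow> \<delta> < 1/2 \<longrightarrow>
            A_instance m p \<epsilon> \<delta> sel hstar P \<longrightarrow>
            ereal_of_enat (A_card sel hstar P m p \<epsilon> \<delta>)
              \<le> ereal (C * (ln (1 / \<delta>) + ln (1 / \<epsilon>) + ln (ln (real m))) * \<epsilon> powr (- p)))"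
proof (intro conjI allI impI)
  fix m \<epsilon> \<delta> sel hstar P
  assume "1 \<le> m" "0 < \<epsilon>" "\<epsilon> < 1" "0 < \<delta>" "\<delta> < 1" and inst: "A_instance m p \<epsilon> \<delta> sel hstar P"
  \<comment> \<open>The zero vector makes the index set of the supremum nonempty, as
    \<open>cSUP_least\<close> requires.\<close>
  moreover have "lp_norm p m (\<lambda>_. 0) \<le> 1" by (simp add: lp_norm_def)
  ultimately show "(SUP x\<in>{x. lp_norm p m x \<le> 1}. measure_pmf.prob P
      {s. linf_norm m (\<lambda>i. A_output sel hstar m p \<epsilon> \<delta> s x i - x i) > \<epsilon>}) \<le> \<delta>"
    using assms by (intro cSUP_least A_error_prob) auto
next
  show "\<exists>C>0. \<forall>(m::nat) (\<epsilon>::real) (\<delta>::real) sel hstar P.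
      16 \<le> m \<longrightarrow> 0 < \<epsilon> \<longrightarrow> \<epsilon> < 1/2 \<longrightarrow> 0 < \<delta> \<longrightarrow> \<delta> < 1/2 \<longrightarrow>
      A_instance m p \<epsilon> \<delta> sel hstar P \<longrightarrow>
      ereal_of_enat (A_card sel hstar P m p \<epsilon> \<delta>)
        \<le> ereal (C * (ln (1 / \<delta>) + ln (1 / \<epsilon>) + ln (ln (real m))) * \<epsilon> powr (- p))"
  proof (intro exI[of _ "card_const p"] conjI allI impI card_const_pos)
    fix m \<epsilon> \<delta> sel hstar P
    assume hyps: "16 \<le> m" "0 < \<epsilon>" "\<epsilon> < 1/2" "0 < \<delta>" "\<delta> < 1/2"
      and inst: "A_instance m p \<epsilon> \<delta> sel hstar P"
    let ?N = "A_k p \<epsilon> * (4 * A_R p \<epsilon> \<delta> + 2 * spot_steps m + 3)"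
    have "A_card sel hstar P m p \<epsilon> \<delta> \<le> enat ?N"
      unfolding A_card_def using inst
      by (intro SUP_least) (auto simp: A_instance_def intro!: length_A_queries)
    then have "ereal_of_enat (A_card sel hstar P m p \<epsilon> \<delta>) \<le> ereal_of_enat (enat ?N)"
      by (simp only: ereal_of_enat_le_iff)
    also have "\<dots> = ereal (real ?N)" by (simp only: ereal_of_enat_simps)
    also have "\<dots> \<le> ereal (card_const p * (ln (1 / \<delta>) + ln (1 / \<epsilon>) + ln (ln (real m))) * \<epsilon> powr (- p))"
      using A_card_bound[OF assms hyps(2-5) hyps(1)] by (simp only: ereal_less_eq)
    finally show "ereal_of_enat (A_card sel hstar P m p \<epsilon> \<delta>)
        \<le> ereal (card_const p * (ln (1 / \<delta>) + ln (1 / \<epsilon>) + ln (ln (real m))) * \<epsilon> powr (- p))" .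
  qed
qed

end
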